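(* Let the number of farmers $p\in\mathbb{N}$ be fixed and let $\Omega\subset\mathbb{Z}^{s\times p}$ be a fixed, finite set of weight matrices. Consider instances of the land consolidation problem (defined in the context) with $p$ farmers and $n$ lots in which all weight matrices satisfy $W^j\in\Omega$. Then: (i) a feasible partition $\pi$ minimizing $$f_1(\pi)=\sum_{i=1}^p\sum_{j\in\pi_i}\omega_j\|v_i-z_j\|^2$$ can be computed in polynomial time; (ii) a feasible partition $\pi$ minimizing $$f_3(\pi)=\sum_{i=1}^p\frac{1}{\kappa_i}\sum_{j\in\pi_i}\omega_j\|v_i-z_j\|^2$$ can be computed in polynomial time; (iii) for the minimization over feasible partitions of $$f_2(\pi)=\sum_{i=1}^p\frac{1}{\sum_{j\in\pi_i}\omega_j}\sum_{j\in\pi_i}\omega_j\|v_i-z_j\|^2,$$ a $\bigl(\max_{i\le p}\frac{\kappa_i}{\kappa_i^-}\bigr)\bigl(\max_{i\le p}\frac{\kappa_i^+}{\kappa_i}\bigr)$-approximation can be computed in polynomial time, i.e. a feasible partition $\pi$ with $f_2(\pi)\le\bigl(\max_{i\le p}\frac{\kappa_i}{\kappa_i^-}\bigr)\bigl(\max_{i\le p}\frac{\kappa_i^+}{\kappa_i}\bigr)\cdot f_2(\pi')$ for every feasible partition $\pi'$.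
   Context: Land consolidation problem. There are $n$ lots (items) $1,\dots,n$ to be distributed among $p$ farmers (clusters) $1,\dots,p$. The lots have $s\ge1$ features. Each lot $j$ has a weight matrix $W^j\in\mathbb{Z}^{s\times p}$ whose $i$-th column $W^j_i\in\mathbb{Z}^s$ lists the contribution of lot $j$ to farmer $i$'s totals in the $s$ features if lot $j$ is assigned to farmer $i$. One fixed component of these columns is the size of the lot: it has the same value $\omega_j>0$ in every column $W^j_1,\dots,W^j_p$. Each lot $j$ has a location $z_j\in\mathbb{Q}^2$ and each farmer $i$ has a farmstead location $v_i\in\mathbb{Q}^2$; $\|\cdot\|$ is the Euclidean norm. Each farmer $i$ has accepted lower and upper bound vectors $B_i^-,B_i^+\in\mathbb{Q}^s$. A partition $\pi=(\pi_1,\dots,\pi_p)$ is an ordered tuple of pairwise disjoint subsets of $\{1,\dots,n\}$ with union $\{1,\dots,n\}$, where $\pi_i$ is the set of lots assigned to farmer $i$. It is feasible if $B_i^-\le\sum_{j\in\pi_i}W^j_i\le B_i^+$ componentwise for all $i\le p$. The input also contains the original distribution of the lots (a partition), which is feasible. $\kappa_i>0$ denotes the original total size of farmer $i$'s lots (the sum of $\omega_j$ over the lots originally belonging to farmer $i$), and $\kappa_i^-,\kappa_i^+$ denote the accepted lower and upper bounds on the total size of farmer $i$'s lots, i.e. the size components of $B_i^-$ and $B_i^+$; it is assumed that $\kappa_i^->0$. Thus $\kappa_i^-\le\sum_{j\in\pi_i}\omega_j\le\kappa_i^+$ for every feasible $\pi$. Polynomial time means running time polynomial in $n$ and in the binary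 encoding length of the input data ($B_i^{\pm}$, $v_i$, $z_j$, $\omega_j$, original distribution), with $p$, $s$ and $\Omega$ regarded as constants. *)

theory Defs
  imports
    "Jordan_Normal_Form.Matrix"
    "HOL-Analysis.Product_Vector"
    "HOL-Computational_Algebra.Polynomial"
    "HOL-Library.Log_Nat"
begin

section \<open>Polynomial time\<close>

text \<open>
  The model of computation is the random access machine with logarithmic cost criterion
  (Cook and Reckhow; Aho, Hopcroft and Ullman), which is polynomially equivalent to the Turing
  machine on binary encoded integers.  Programs are structured (while and if instead of jumps).
  The memory consists of integer cells, addressed by integers.  Every access is charged the
  binary length of the address and of the content, every arithmetic operation is charged its
  bit complexity by the schoolbook method.
\<close>

type_synonym mem = "int \<Rightarrow> int"

text \<open>Number of binary digits plus a sign bit.\<close>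

definition bit_length :: "int \<Rightarrow> nat" where
  "bit_length k = 1 + floorlog 2 (nat \<bar>k\<bar>)"

datatype expr =
    Num int
  | Cell expr
  | Add expr expr
  | Sub expr expr
  | Mul expr expr
  | Div expr expr

primrec val :: "expr \<Rightarrow> mem \<Rightarrow> int" where
  "val (Num k) m = k"
| "val (Cell a) m = m (val a m)"
| "val (Add a b) m = val a m + val b m"
| "val (Sub a b) m = val a m - val b m"
| "val (Mul a b) m = val a m * val b m"
| "val (Div a b) m = val a m div val b m"

primrec cost :: "expr \<Rightarrow> mem \<Rightarrow> nat" where
  "cost (Num k) m = bit_length k"
| "cost (Cell a) m = cost a m + bit_length (val a m) + bit_length (m (val a m))"
| "cost (Add a b) m = cost a m + cost b m + (bit_length (val a m) + bit_length (val b m))"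
| "cost (Sub a b) m = cost a m + cost b m + (bit_length (val a m) + bit_length (val b m))"
| "cost (Mul a b) m = cost a m + cost b m + bit_length (val a m) * bit_length (val b m)"
| "cost (Div a b) m = cost a m + cost b m + bit_length (val a m) * bit_length (val b m)"

text \<open>\<open>Assign a e\<close> stores the value of \<open>e\<close> in the cell whose address is the value of \<open>a\<close>.
  The tests of \<open>If\<close> and \<open>While\<close> succeed if the value of the expression is positive.\<close>

datatype com =
    Skip
  | Assign expr expr
  | Seq com com
  | If expr com com
  | While expr com

text \<open>\<open>exec c m t m'\<close>: started in memory \<open>m\<close>, the program \<open>c\<close> halts after time \<open>t\<close> with
  memory \<open>m'\<close>.\<close>

inductive exec :: "com \<Rightarrow> mem \<Rightarrow> nat \<Rightarrow> mem \<Rightarrow> bool" where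
  Skip: "exec Skip m 1 m"
| Assign: "exec (Assign a e) m
     (cost a m + cost e m + bit_length (val a m) + bit_length (val e m))
     (m(val a m := val e m))"
| Seq: "exec c m t m' \<Longrightarrow> exec d m' u m'' \<Longrightarrow> exec (Seq c d) m (t + u) m''"
| IfTrue: "0 < val e m \<Longrightarrow> exec c m t m' \<Longrightarrow> exec (If e c d) m (cost e m + 1 + t) m'"
| IfFalse: "\<not> 0 < val e m \<Longrightarrow> exec d m t m' \<Longrightarrow> exec (If e c d) m (cost e m + 1 + t) m'"
| WhileFalse: "\<not> 0 < val e m \<Longrightarrow> exec (While e c) m (cost e m + 1) m"
| WhileTrue: "0 < val e m \<Longrightarrow> exec c m t m' \<Longrightarrow> exec (While e c) m' u m''
     \<Longrightarrow> exec (While e c) m (cost e m + 1 + t + u) m''"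

lemma exec_deterministic:
  "exec c m t m' \<Longrightarrow> exec c m u m'' \<Longrightarrow> u = t \<and> m'' = m'"
proof (induction arbitrary: u m'' rule: exec.induct)
  case Skip then show ?case by (auto elim: exec.cases)
next
  case Assign then show ?case by (auto elim: exec.cases)
next
  case (Seq c m t m' d u m'')
  from Seq.prems show ?case
    by (cases rule: exec.cases) (use Seq.IH in blast)+
next
  case (IfTrue e m c t m' d)
  from IfTrue.prems show ?case
    by (cases rule: exec.cases) (use IfTrue in blast)+
next
  case (IfFalse e m d t m' c)
  from IfFalse.prems show ?case
    by (cases rule: exec.cases) (use IfFalse in blast)+
next
  case (WhileFalse e m c)
  from WhileFalse.prems show ?case
    by (cases rule: exec.cases) (use WhileFalse in blast)+
next
  case (WhileTrue e m c t m' u m'')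
  from WhileTrue.prems show ?case
    by (cases rule: exec.cases) (use WhileTrue in blast)+
qed

text \<open>Input and output are lists of integers.  A list \<open>xs\<close> is held with its length in cell 0 and
  its entries in cells \<open>1, \<dots>, length xs\<close>; all other cells are 0 initially.\<close>

definition load :: "int list \<Rightarrow> mem" where
  "load xs a = (if a = 0 then int (length xs)
     else if 0 < a \<and> a \<le> int (length xs) then xs ! nat (a - 1) else 0)"

definition read_out :: "mem \<Rightarrow> int list" where
  "read_out m = map (\<lambda>k. m (int k + 1)) [0..<nat (m 0)]"

definition binary_length :: "int list \<Rightarrow> nat" where
  "binary_length xs = (\<Sum>x\<leftarrow>xs. bit_length x)"

text \<open>One program computes, for every instance \<open>x \<in> X\<close> presented in the encoding \<open>enc x\<close>, an output
  \<open>y\<close> with \<open>sol x y\<close>, in time polynomial in the binary length of the encoding.\<close>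

definition poly_time_computable ::
    "'a set \<Rightarrow> ('a \<Rightarrow> int list) \<Rightarrow> ('a \<Rightarrow> int list \<Rightarrow> bool) \<Rightarrow> bool" where
  "poly_time_computable X enc sol \<longleftrightarrow>
     (\<exists>c. \<exists>P :: nat poly. \<forall>x\<in>X. \<exists>t m.
        exec c (load (enc x)) t m \<and> t \<le> poly P (binary_length (enc x)) \<and> sol x (read_out m))"

section \<open>The land consolidation problem\<close>

text \<open>Lots, farmers and features are numbered from 0.  The functions below are only relevant on
  \<open>{..<num_lots I}\<close> and \<open>{..<num_farmers I}\<close>, respectively.  The component \<open>size_feature I\<close> is the
  one holding the size of the lots.\<close>

record land =
  num_lots :: nat
  num_farmers :: nat
  num_features :: nat
  size_feature :: nat
  weight :: "nat \<Rightarrow> int mat"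
  lot_loc :: "nat \<Rightarrow> rat \<times> rat"
  farm_loc :: "nat \<Rightarrow> rat \<times> rat"
  lower :: "nat \<Rightarrow> rat vec"
  upper :: "nat \<Rightarrow> rat vec"
  original :: "nat \<Rightarrow> nat set"

definition is_partition :: "land \<Rightarrow> (nat \<Rightarrow> nat set) \<Rightarrow> bool" where
  "is_partition I \<pi> \<longleftrightarrow>
     disjoint_family_on \<pi> {..<num_farmers I} \<and> (\<Union>i<num_farmers I. \<pi> i) = {..<num_lots I}"

definition feasible :: "land \<Rightarrow> (nat \<Rightarrow> nat set) \<Rightarrow> bool" where
  "feasible I \<pi> \<longleftrightarrow> is_partition I \<pi> \<and>
     (\<forall>i<num_farmers I. \<forall>k<num_features I.
        lower I i $ k \<le> of_int (\<Sum>j\<in>\<pi> i. weight I j $$ (k, i)) \<and>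
        of_int (\<Sum>j\<in>\<pi> i. weight I j $$ (k, i)) \<le> upper I i $ k)"

text \<open>The size of a lot is read off column 0; \<open>land_instance\<close> below requires all columns to agree.\<close>

definition lot_size :: "land \<Rightarrow> nat \<Rightarrow> int" where
  "lot_size I j = weight I j $$ (size_feature I, 0)"

definition orig_size :: "land \<Rightarrow> nat \<Rightarrow> int" where
  "orig_size I i = (\<Sum>j\<in>original I i. lot_size I j)"

definition lower_size :: "land \<Rightarrow> nat \<Rightarrow> rat" where
  "lower_size I i = lower I i $ size_feature I"

definition upper_size :: "land \<Rightarrow> nat \<Rightarrow> rat" where
  "upper_size I i = upper I i $ size_feature I"

definition land_instance :: "land \<Rightarrow> bool" where
  "land_instance I \<longleftrightarrow>
     0 < num_farmers I \<and>
     size_feature I < num_features I \<and>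
     (\<forall>j<num_lots I. weight I j \<in> carrier_mat (num_features I) (num_farmers I) \<and>
        0 < lot_size I j \<and>
        (\<forall>i<num_farmers I. weight I j $$ (size_feature I, i) = lot_size I j)) \<and>
     (\<forall>i<num_farmers I.
        lower I i \<in> carrier_vec (num_features I) \<and>
        upper I i \<in> carrier_vec (num_features I) \<and>
        0 < lower_size I i \<and> 0 < orig_size I i) \<and>
     feasible I (original I)"

definition instances :: "nat \<Rightarrow> nat \<Rightarrow> int mat set \<Rightarrow> land set" where
  "instances p s \<Omega> = {I. land_instance I \<and> num_farmers I = p \<and> num_features I = s \<and>
     (\<forall>j<num_lots I. weight I j \<in> \<Omega>)}"

subsection \<open>Objective functions\<close>

definition real_point :: "rat \<times> rat \<Rightarrow> real \<times> real" where
  "real_point z = (of_rat (fst z), of_rat (snd z))"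

definition sq_dist :: "land \<Rightarrow> nat \<Rightarrow> nat \<Rightarrow> real" where
  "sq_dist I i j = (norm (real_point (farm_loc I i) - real_point (lot_loc I j)))\<^sup>2"

definition f1 :: "land \<Rightarrow> (nat \<Rightarrow> nat set) \<Rightarrow> real" where
  "f1 I \<pi> = (\<Sum>i<num_farmers I. \<Sum>j\<in>\<pi> i. of_int (lot_size I j) * sq_dist I i j)"

definition f2 :: "land \<Rightarrow> (nat \<Rightarrow> nat set) \<Rightarrow> real" where
  "f2 I \<pi> = (\<Sum>i<num_farmers I. 1 / of_int (\<Sum>j\<in>\<pi> i. lot_size I j) *
     (\<Sum>j\<in>\<pi> i. of_int (lot_size I j) * sq_dist I i j))"

definition f3 :: "land \<Rightarrow> (nat \<Rightarrow> nat set) \<Rightarrow> real" where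
  "f3 I \<pi> = (\<Sum>i<num_farmers I. 1 / of_int (orig_size I i) *
     (\<Sum>j\<in>\<pi> i. of_int (lot_size I j) * sq_dist I i j))"

definition approx_factor :: "land \<Rightarrow> real" where
  "approx_factor I =
     (MAX i\<in>{..<num_farmers I}. of_int (orig_size I i) / of_rat (lower_size I i)) *
     (MAX i\<in>{..<num_farmers I}. of_rat (upper_size I i) / of_int (orig_size I i))"

subsection \<open>Encoding of instances and partitions\<close>

text \<open>A partition is encoded by listing the owners of the lots \<open>0, \<dots>, n - 1\<close>.\<close>

definition owner :: "land \<Rightarrow> (nat \<Rightarrow> nat set) \<Rightarrow> nat \<Rightarrow> nat" where
  "owner I \<pi> j = (THE i. i < num_farmers I \<and> j \<in> \<pi> i)"

definition encode_partition :: "land \<Rightarrow> (nat \<Rightarrow> nat set) \<Rightarrow> int list" where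
  "encode_partition I \<pi> = map (\<lambda>j. int (owner I \<pi> j)) [0..<num_lots I]"

definition encode_rat :: "rat \<Rightarrow> int list" where
  "encode_rat r = [fst (quotient_of r), snd (quotient_of r)]"

definition encode_point :: "rat \<times> rat \<Rightarrow> int list" where
  "encode_point z = encode_rat (fst z) @ encode_rat (snd z)"

definition encode_vec :: "rat vec \<Rightarrow> int list" where
  "encode_vec v = concat (map encode_rat (list_of_vec v))"

definition encode_mat :: "int mat \<Rightarrow> int list" where
  "encode_mat A = concat (mat_to_list A)"

definition encode_farmer :: "land \<Rightarrow> nat \<Rightarrow> int list" where
  "encode_farmer I i = encode_vec (lower I i) @ encode_vec (upper I i) @ encode_point (farm_loc I i)"

definition encode_lot :: "land \<Rightarrow> nat \<Rightarrow> int list" where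
  "encode_lot I j = encode_mat (weight I j) @ encode_point (lot_loc I j)"

definition encode :: "land \<Rightarrow> int list" where
  "encode I =
     [int (num_lots I), int (num_farmers I), int (num_features I), int (size_feature I)] @
     concat (map (encode_farmer I) [0..<num_farmers I]) @
     concat (map (encode_lot I) [0..<num_lots I]) @
     encode_partition I (original I)"

text \<open>Hence a bound polynomial in \<open>n\<close> and the encoding length is the same as a bound polynomial in
  the encoding length.\<close>

lemma num_lots_le_binary_length: "num_lots I \<le> binary_length (encode I)"
proof -
  have len: "length xs \<le> binary_length xs" for xs
    by (induction xs) (auto simp: binary_length_def bit_length_def)
  have "num_lots I \<le> length (encode I)"
    by (simp add: encode_def encode_partition_def)
  with len show ?thesis
    using le_trans by blast
qed

end

theory Submission
  imports Defs
begin

text \<open>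
  Since the weight matrices come from a fixed finite set, a vector of accumulated weights of the
  farmers has only polynomially many values.  It is encoded, together with the number of lots
  assigned so far, in the digits of one integer \<open>q\<close> to a base \<open>B = 2 M n + 1\<close>, and a dynamic program
  runs through all \<open>q\<close> in increasing order.  The costs are made integral by multiplication with a
  power of a common multiple \<open>D\<close> of all denominators.  The value stored at a state is the scaled cost
  times \<open>p ^ n\<close> plus the owners of the lots written as the digits of a number less than \<open>p ^ n\<close>,
  so the optimal partition can be read off the optimal value.  For \<open>f2\<close> a minimizer of \<open>f3\<close> will do,
  because the two objectives differ in each summand at most by the factors \<open>\<kappa>\<^sub>i / \<kappa>\<^sub>i\<^sup>-\<close> and
  \<open>\<kappa>\<^sub>i\<^sup>+ / \<kappa>\<^sub>i\<close>.
\<close>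

section \<open>Programs with a polynomial number of steps\<close>

text \<open>The number of assigned lots is the leading digit of \<open>q\<close>, so every
  assignment step leads to a larger state and increasing order is a topological order: a state is
  left only after its value is final. For constant \<open>p\<close> and \<open>s\<close> the
  \<open>p * s\<close> accumulated entries, each with linearly many values, give polynomially many
  states. Of the set of weight matrices only a bound \<open>M\<close> on the entries matters. The
  machine charges for the length of numbers, and repeated products could double that length at every
  step. The program is laid out so that each product has a short factor (a constant, input data,
  \<open>D\<close>, an original size, a power of the base), while \<open>p ^ n\<close>, the states
  and the table values may be long. Counting instructions then suffices for the time bound.
  \<open>f2\<close> itself does not fit the dynamic program: its denominators depend on the whole
  partition, so the cost of a lot is not determined by its owner. \<open>f3\<close> freezes the
  denominators at the original sizes.\<close>

lemma bit_length_pos [simp]: "0 < bit_length k"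
  by (simp add: bit_length_def)

lemma bit_length_le_Suc_iff: "bit_length k \<le> Suc w \<longleftrightarrow> \<bar>k\<bar> < 2 ^ w"
proof -
  have "bit_length k \<le> Suc w \<longleftrightarrow> nat \<bar>k\<bar> < 2 ^ w"
    by (auto simp: bit_length_def floorlog_le_iff)
  also have "\<dots> \<longleftrightarrow> \<bar>k\<bar> < 2 ^ w"
    by (simp add: nat_less_iff)
  finally show ?thesis .
qed

lemma bit_length_mono: "\<bar>x\<bar> \<le> \<bar>y\<bar> \<Longrightarrow> bit_length x \<le> bit_length y"
  by (simp add: bit_length_def floorlog_mono nat_mono)

lemma abs_less_bit_length: "\<bar>k\<bar> < 2 ^ (bit_length k - 1)"
  using bit_length_le_Suc_iff[of k "bit_length k - 1"] bit_length_pos[of k] by simp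

lemma bit_length_add: "bit_length (x + y) \<le> max (bit_length x) (bit_length y) + 1"
proof -
  define w where "w = max (bit_length x) (bit_length y) - 1"
  have w: "max (bit_length x) (bit_length y) = Suc w"
    unfolding w_def using bit_length_pos[of x] by linarith
  have "\<bar>x\<bar> < 2 ^ w" "\<bar>y\<bar> < 2 ^ w"
    unfolding bit_length_le_Suc_iff[symmetric] using w by linarith+
  then have "\<bar>x + y\<bar> < 2 ^ Suc w" by simp
  then show ?thesis unfolding w bit_length_le_Suc_iff[symmetric] by simp
qed

lemma bit_length_uminus [simp]: "bit_length (- x) = bit_length x"
  by (simp add: bit_length_def)

lemma bit_length_diff: "bit_length (x - y) \<le> max (bit_length x) (bit_length y) + 1"
  using bit_length_add[of x "- y"] by simp

text \<open>The carry bit is absorbed because \<open>u\<close> and \<open>v\<close> are positive: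
  \<open>max u v + 1\<close> is at most \<open>u + v\<close>. The common part \<open>L\<close> is
  counted only once.\<close>

lemma bit_length_add_le:
  assumes "bit_length x \<le> L + u" "bit_length y \<le> L + v" "0 < u" "0 < v"
  shows "bit_length (x + y) \<le> L + (u + v)" "bit_length (x - y) \<le> L + (u + v)"
  using assms bit_length_add[of x y] bit_length_diff[of x y] by auto

lemma bit_length_mult: "bit_length (x * y) \<le> bit_length x + bit_length y"
proof -
  have "\<bar>x * y\<bar> < 2 ^ (bit_length x - 1) * 2 ^ (bit_length y - 1)"
    unfolding abs_mult by (intro mult_strict_mono abs_less_bit_length) auto
  then have "bit_length (x * y) \<le> Suc (bit_length x - 1 + (bit_length y - 1))"
    unfolding bit_length_le_Suc_iff by (simp add: power_add)
  then show ?thesis using bit_length_pos[of x] bit_length_pos[of y] by linarith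
qed

text \<open>Rounding towards minus infinity does not spoil the bound, since a nonzero integer
  divisor has absolute value at least 1; division by 0 gives 0.\<close>

lemma abs_div_le: "\<bar>x div y\<bar> \<le> \<bar>x :: int\<bar>"
proof (cases "y = 0")
  case False
  have "\<bar>x div y\<bar> \<le> \<bar>x\<bar>" if "y > 0" for x y :: int
  proof (cases "x \<ge> 0")
    case True
    with that zdiv_mono2[of x 1 y] show ?thesis by (simp add: pos_imp_zdiv_nonneg_iff)
  next
    case False
    with that zdiv_mono2_neg[of x 1 y] div_neg_pos_less0[of x y] show ?thesis by simp
  qed
  from this[of y x] this[of "- y" "- x"] False show ?thesis
    by (cases "y > 0") auto
qed simp

lemma bit_length_div: "bit_length (x div y) \<le> bit_length x"
  by (rule bit_length_mono[OF abs_div_le])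

lemma bit_length_nonneg_le: "0 \<le> x \<Longrightarrow> bit_length x \<le> nat x + 1"
proof -
  assume "0 \<le> x"
  have "nat x < 2 ^ nat x" by simp
  then have "int (nat x) < int (2 ^ nat x)" by (simp only: of_nat_less_iff)
  with \<open>0 \<le> x\<close> have "\<bar>x\<bar> < 2 ^ nat x" by simp
  then show ?thesis unfolding bit_length_le_Suc_iff[symmetric] by simp
qed

text \<open>An expression is \<open>short\<close> if the cells it reads have bit length at most \<open>w\<close>, and \<open>ok\<close> if
  every product in it has a short factor.  Assigning the value of an \<open>ok\<close> expression increases the
  maximal bit length of the memory at most by a constant multiple of \<open>w\<close>, so no bound on the
  contents of the memory has to be maintained by hand.\<close>

primrec esize :: "expr \<Rightarrow> nat" where
  "esize (Num k) = bit_length k"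
| "esize (Cell a) = 1"
| "esize (Add a b) = esize a + esize b"
| "esize (Sub a b) = esize a + esize b"
| "esize (Mul a b) = esize a + esize b"
| "esize (Div a b) = esize a + esize b"

primrec short :: "nat \<Rightarrow> expr \<Rightarrow> mem \<Rightarrow> bool" where
  "short w (Num k) m \<longleftrightarrow> True"
| "short w (Cell a) m \<longleftrightarrow> bit_length (m (val a m)) \<le> w"
| "short w (Add a b) m \<longleftrightarrow> short w a m \<and> short w b m"
| "short w (Sub a b) m \<longleftrightarrow> short w a m \<and> short w b m"
| "short w (Mul a b) m \<longleftrightarrow> short w a m \<and> short w b m"
| "short w (Div a b) m \<longleftrightarrow> short w a m \<and> short w b m"

primrec ok :: "nat \<Rightarrow> expr \<Rightarrow> mem \<Rightarrow> bool" where
  "ok w (Num k) m \<longleftrightarrow> True"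
| "ok w (Cell a) m \<longleftrightarrow> ok w a m"
| "ok w (Add a b) m \<longleftrightarrow> ok w a m \<and> ok w b m"
| "ok w (Sub a b) m \<longleftrightarrow> ok w a m \<and> ok w b m"
| "ok w (Mul a b) m \<longleftrightarrow> ok w a m \<and> ok w b m \<and> (short w a m \<or> short w b m)"
| "ok w (Div a b) m \<longleftrightarrow> ok w a m \<and> ok w b m"

text \<open>Coefficient of \<open>W\<^sup>2\<close> in the cost bound, where \<open>W\<close> bounds
  both \<open>w\<close> and the length of all cells. The factors 2 and 4 come from the length bound
  \<open>2 * esize e * W\<close> for each operand.\<close>

primrec ecost :: "expr \<Rightarrow> nat" where
  "ecost (Num k) = bit_length k"
| "ecost (Cell a) = ecost a + esize a + 2"
| "ecost (Add a b) = ecost a + ecost b + 2 * (esize a + esize b)"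
| "ecost (Sub a b) = ecost a + ecost b + 2 * (esize a + esize b)"
| "ecost (Mul a b) = ecost a + ecost b + 4 * (esize a * esize b)"
| "ecost (Div a b) = ecost a + ecost b + 4 * (esize a * esize b)"

lemma esize_pos: "0 < esize e"
  by (induction e) auto

lemma short_bit_length:
  assumes "1 \<le> w"
  shows "short w e m \<Longrightarrow> bit_length (val e m) \<le> esize e * w"
proof (induction e)
  case (Num k)
  then show ?case using assms by simp
next
  case (Add a b)
  then show ?case
    using bit_length_add_le(1)[of _ 0 "esize a * w" _ "esize b * w"] assms esize_pos[of a] esize_pos[of b]
    by (simp add: distrib_right)
next
  case (Sub a b)
  then show ?case
    using bit_length_add_le(2)[of _ 0 "esize a * w" _ "esize b * w"] assms esize_pos[of a] esize_pos[of b]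
    by (simp add: distrib_right)
next
  case (Mul a b)
  with bit_length_mult[of "val a m" "val b m"] show ?case by (simp add: algebra_simps)
next
  case (Div a b)
  with bit_length_div[of "val a m" "val b m"] show ?case by (simp add: algebra_simps)
qed simp

text \<open>In a product the short factor contributes a multiple of \<open>w\<close> only, so
  \<open>L\<close> enters once rather than twice; this is what excludes doubling.\<close>

lemma ok_bit_length:
  assumes "1 \<le> w" and "\<And>a. bit_length (m a) \<le> L"
  shows "ok w e m \<Longrightarrow> bit_length (val e m) \<le> L + esize e * w"
proof (induction e)
  case (Num k)
  show ?case using assms by (simp add: trans_le_add2)
next
  case (Cell a)
  show ?case using assms(2) by (simp add: trans_le_add1)
next
  case (Add a b)
  then show ?case
    using bit_length_add_le(1)[of _ L "esize a * w" _ "esize b * w"] assms esize_pos[of a] esize_pos[of b]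
    by (simp add: distrib_right)
next
  case (Sub a b)
  then show ?case
    using bit_length_add_le(2)[of _ L "esize a * w" _ "esize b * w"] assms esize_pos[of a] esize_pos[of b]
    by (simp add: distrib_right)
next
  case (Mul a b)
  then have "bit_length (val a m) \<le> esize a * w \<or> bit_length (val b m) \<le> esize b * w"
    using short_bit_length[OF assms(1)] by auto
  with Mul bit_length_mult[of "val a m" "val b m"] show ?case by (auto simp: algebra_simps)
next
  case (Div a b)
  with bit_length_div[of "val a m" "val b m"] show ?case by (simp add: algebra_simps)
qed

lemma cost_le:
  assumes "1 \<le> w" and "\<And>a. bit_length (m a) \<le> L" and "w \<le> W" and "L \<le> W"
  shows "ok w e m \<Longrightarrow> cost e m \<le> ecost e * W\<^sup>2"
proof (induction e)
  have W: "1 \<le> W" using assms by simp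
  then have W2: "W \<le> W\<^sup>2" by (simp add: power2_eq_square)
  have len: "bit_length (val e m) \<le> 2 * (esize e * W)" if "ok w e m" for e
  proof -
    have "bit_length (val e m) \<le> L + esize e * w" by (rule ok_bit_length[OF assms(1,2) that])
    also have "\<dots> \<le> esize e * W + esize e * W"
      using assms(3,4) esize_pos[of e] by (intro add_mono mult_le_mono) (auto intro: order_trans)
    finally show ?thesis by simp
  qed
  have lin: "k * W \<le> k * W\<^sup>2" for k using W2 by simp
  {
    case (Num k)
    show ?case using W by (simp add: power2_eq_square)
  next
    case (Cell a)
    have "bit_length (val a m) \<le> L + esize a * w" by (rule ok_bit_length[OF assms(1,2)]) (use Cell in simp)
    also have "\<dots> \<le> W + esize a * W" using assms(3,4) by (intro add_mono mult_le_mono) auto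
    finally have "bit_length (val a m) + bit_length (m (val a m)) \<le> (esize a + 2) * W"
      using assms(2)[of "val a m"] assms(4) by (simp add: algebra_simps)
    with Cell lin[of "esize a + 2"] show ?case by (simp add: algebra_simps)
  next
    case (Add a b)
    with len[of a] len[of b] lin[of "2 * (esize a + esize b)"] show ?case by (simp add: algebra_simps)
  next
    case (Sub a b)
    with len[of a] len[of b] lin[of "2 * (esize a + esize b)"] show ?case by (simp add: algebra_simps)
  next
    case (Mul a b)
    then have "bit_length (val a m) * bit_length (val b m) \<le> (2 * (esize a * W)) * (2 * (esize b * W))"
      by (intro mult_le_mono len) auto
    with Mul show ?case by (simp add: algebra_simps power2_eq_square)
  next
    case (Div a b)
    then have "bit_length (val a m) * bit_length (val b m) \<le> (2 * (esize a * W)) * (2 * (esize b * W))"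
      by (intro mult_le_mono len) auto
    with Div show ?case by (simp add: algebra_simps power2_eq_square)
  }
qed

text \<open>A unit cost version of \<open>exec\<close> that insists on \<open>ok\<close>
  expressions. It separates counting instructions from the length of the numbers.\<close>

inductive steps :: "nat \<Rightarrow> com \<Rightarrow> mem \<Rightarrow> nat \<Rightarrow> mem \<Rightarrow> bool" for w where
  Skip: "steps w Skip m 1 m"
| Assign: "ok w a m \<Longrightarrow> ok w e m \<Longrightarrow> steps w (Assign a e) m 1 (m(val a m := val e m))"
| Seq: "steps w c m t m' \<Longrightarrow> steps w d m' u m'' \<Longrightarrow> steps w (Seq c d) m (t + u) m''"
| IfTrue: "ok w e m \<Longrightarrow> 0 < val e m \<Longrightarrow> steps w c m t m' \<Longrightarrow> steps w (If e c d) m (1 + t) m'"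
| IfFalse: "ok w e m \<Longrightarrow> \<not> 0 < val e m \<Longrightarrow> steps w d m t m' \<Longrightarrow> steps w (If e c d) m (1 + t) m'"
| WhileFalse: "ok w e m \<Longrightarrow> \<not> 0 < val e m \<Longrightarrow> steps w (While e c) m 1 m"
| WhileTrue: "ok w e m \<Longrightarrow> 0 < val e m \<Longrightarrow> steps w c m t m' \<Longrightarrow> steps w (While e c) m' u m''
     \<Longrightarrow> steps w (While e c) m (1 + t + u) m''"

primrec ccost :: "com \<Rightarrow> nat" where
  "ccost Skip = 1"
| "ccost (Assign a e) = ecost a + ecost e + esize a + esize e + 2"
| "ccost (Seq c d) = ccost c + ccost d"
| "ccost (If e c d) = ecost e + 1 + ccost c + ccost d"
| "ccost (While e c) = ecost e + 1 + ccost c"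

lemma step_bounds:
  fixes w :: nat
  assumes "L + n * K * w \<le> W" "1 \<le> n" "1 \<le> K"
  shows "w \<le> W" "L \<le> W"
proof -
  have "1 * 1 * w \<le> n * K * w" using assms by (intro mult_le_mono) auto
  then show "w \<le> W" "L \<le> W" using assms(1) by linarith+
qed

lemma test_cost_le:
  assumes "1 \<le> w" "\<And>a. bit_length (m a) \<le> L" "ok w e m" "ecost e + 1 \<le> K"
    and W: "L + n * K * w \<le> W" "1 \<le> n"
  shows "cost e m + 1 \<le> K * W\<^sup>2"
proof -
  have w: "w \<le> W" "L \<le> W" using step_bounds[OF W] assms(4) by auto
  have "1 \<le> W\<^sup>2" using w \<open>1 \<le> w\<close> by simp
  then have "cost e m + 1 \<le> (ecost e + 1) * W\<^sup>2"
    using cost_le[OF assms(1,2) w assms(3)] by (simp add: algebra_simps)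
  also have "\<dots> \<le> K * W\<^sup>2" using assms(4) by (intro mult_le_mono) auto
  finally show ?thesis .
qed

text \<open>Each of the \<open>n\<close> steps lengthens the cells by at most \<open>K * w\<close>,
  so no cell ever exceeds \<open>W\<close> and each step costs at most \<open>K * W\<^sup>2\<close>.
  In the induction \<open>L\<close> varies, since later parts start from longer cells, while the
  final bound \<open>W\<close> stays fixed.\<close>

lemma exec_if_steps:
  assumes "steps w c m n m'" and "1 \<le> w" and "\<And>a. bit_length (m a) \<le> L"
    and "ccost c \<le> K" and "L + n * K * w \<le> W"
  shows "\<exists>t. exec c m t m' \<and> t \<le> n * K * W\<^sup>2 \<and> (\<forall>a. bit_length (m' a) \<le> L + n * K * w)"
  using assms(1,3,4,5)
proof (induction arbitrary: L rule: steps.induct)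
  case (Skip m)
  then have "w \<le> W" using step_bounds[of L 1 K w W] by simp
  then have "1 * 1 \<le> K * W\<^sup>2" using Skip \<open>1 \<le> w\<close> by (intro mult_le_mono) auto
  with Skip show ?case using exec.Skip[of m] by (intro exI[of _ 1]) (auto intro: trans_le_add1)
next
  case (Assign a m e)
  have K: "ecost a + ecost e + esize a + esize e + 2 \<le> K" using Assign by simp
  have w: "w \<le> W" and L: "L \<le> W"
    by (rule step_bounds[OF Assign.prems(3)]; use K in simp)+
  have W2: "W \<le> W\<^sup>2" using w \<open>1 \<le> w\<close> by (simp add: power2_eq_square)
  have la: "bit_length (val a m) \<le> L + esize a * w" and le: "bit_length (val e m) \<le> L + esize e * w"
    using Assign ok_bit_length[OF \<open>1 \<le> w\<close>] by auto
  have "esize a * w \<le> esize a * W" "esize e * w \<le> esize e * W" using w by auto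
  then have "bit_length (val a m) + bit_length (val e m) \<le> (esize a + esize e + 2) * W"
    using la le L unfolding distrib_right by linarith
  also have "\<dots> \<le> (esize a + esize e + 2) * W\<^sup>2" using W2 by (intro mult_le_mono) auto
  finally have "cost a m + cost e m + bit_length (val a m) + bit_length (val e m)
      \<le> (ecost a + ecost e + esize a + esize e + 2) * W\<^sup>2"
    using cost_le[OF \<open>1 \<le> w\<close> Assign(3) w L Assign(1)] cost_le[OF \<open>1 \<le> w\<close> Assign(3) w L Assign(2)]
    by (simp add: algebra_simps)
  also have "\<dots> \<le> 1 * K * W\<^sup>2" using K unfolding mult_1 by (intro mult_le_mono) auto
  finally have t: "cost a m + cost e m + bit_length (val a m) + bit_length (val e m) \<le> 1 * K * W\<^sup>2" .
  have "esize e * w \<le> K * w" using K by (intro mult_le_mono) auto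
  then have l: "bit_length (val e m) \<le> L + 1 * K * w" using le by linarith
  show ?case
  proof (intro exI conjI allI)
    show "exec (Assign a e) m (cost a m + cost e m + bit_length (val a m) + bit_length (val e m))
      (m(val a m := val e m))" by (rule exec.Assign)
    show "bit_length ((m(val a m := val e m)) x) \<le> L + 1 * K * w" for x
      using Assign.prems(1) l by (simp add: trans_le_add1)
  qed (rule t)
next
  case (Seq c m t m' d u m'')
  have s: "(t + u) * K * w = t * K * w + u * K * w" "(t + u) * K * W\<^sup>2 = t * K * W\<^sup>2 + u * K * W\<^sup>2"
    by (simp_all add: add_mult_distrib)
  have p: "ccost c \<le> K" "L + t * K * w \<le> W" "ccost d \<le> K" "L + t * K * w + u * K * w \<le> W"
    using Seq.prems(2,3) s by simp_all
  from Seq.IH(1)[OF Seq.prems(1) p(1,2)] obtain t1 where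
    1: "exec c m t1 m'" "t1 \<le> t * K * W\<^sup>2" "\<And>a. bit_length (m' a) \<le> L + t * K * w" by blast
  from Seq.IH(2)[OF 1(3) p(3,4)] obtain t2 where
    2: "exec d m' t2 m''" "t2 \<le> u * K * W\<^sup>2" "\<And>a. bit_length (m'' a) \<le> L + t * K * w + u * K * w"
    by blast
  show ?case
  proof (intro exI conjI allI)
    show "exec (Seq c d) m (t1 + t2) m''" by (rule exec.Seq[OF 1(1) 2(1)])
    show "t1 + t2 \<le> (t + u) * K * W\<^sup>2" unfolding s using 1(2) 2(2) by linarith
    show "bit_length (m'' a) \<le> L + (t + u) * K * w" for a unfolding s using 2(3)[of a] by linarith
  qed
next
  case (IfTrue e m c t m' d)
  have e: "cost e m + 1 \<le> K * W\<^sup>2"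
    by (rule test_cost_le[of w m L e K "1 + t"]) (use IfTrue.prems IfTrue.hyps \<open>1 \<le> w\<close> in auto)
  have s: "(1 + t) * K * w = K * w + t * K * w" "(1 + t) * K * W\<^sup>2 = K * W\<^sup>2 + t * K * W\<^sup>2"
    by (simp_all add: add_mult_distrib)
  have p: "ccost c \<le> K" "L + t * K * w \<le> W" using IfTrue.prems(2,3) s by simp_all
  from IfTrue.IH[OF IfTrue.prems(1) p] obtain t1 where
    1: "exec c m t1 m'" "t1 \<le> t * K * W\<^sup>2" "\<And>a. bit_length (m' a) \<le> L + t * K * w" by blast
  show ?case
  proof (intro exI conjI allI)
    show "exec (If e c d) m (cost e m + 1 + t1) m'" by (rule exec.IfTrue[OF IfTrue.hyps(2) 1(1)])
    show "cost e m + 1 + t1 \<le> (1 + t) * K * W\<^sup>2" unfolding s using e 1(2) by linarith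
    show "bit_length (m' a) \<le> L + (1 + t) * K * w" for a unfolding s using 1(3)[of a] by linarith
  qed
next
  case (IfFalse e m d t m' c)
  have e: "cost e m + 1 \<le> K * W\<^sup>2"
    by (rule test_cost_le[of w m L e K "1 + t"]) (use IfFalse.prems IfFalse.hyps \<open>1 \<le> w\<close> in auto)
  have s: "(1 + t) * K * w = K * w + t * K * w" "(1 + t) * K * W\<^sup>2 = K * W\<^sup>2 + t * K * W\<^sup>2"
    by (simp_all add: add_mult_distrib)
  have p: "ccost d \<le> K" "L + t * K * w \<le> W" using IfFalse.prems(2,3) s by simp_all
  from IfFalse.IH[OF IfFalse.prems(1) p] obtain t1 where
    1: "exec d m t1 m'" "t1 \<le> t * K * W\<^sup>2" "\<And>a. bit_length (m' a) \<le> L + t * K * w" by blast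
  show ?case
  proof (intro exI conjI allI)
    show "exec (If e c d) m (cost e m + 1 + t1) m'" by (rule exec.IfFalse[OF IfFalse.hyps(2) 1(1)])
    show "cost e m + 1 + t1 \<le> (1 + t) * K * W\<^sup>2" unfolding s using e 1(2) by linarith
    show "bit_length (m' a) \<le> L + (1 + t) * K * w" for a unfolding s using 1(3)[of a] by linarith
  qed
next
  case (WhileFalse e m c)
  have e: "cost e m + 1 \<le> K * W\<^sup>2"
    by (rule test_cost_le[of w m L e K 1]) (use WhileFalse \<open>1 \<le> w\<close> in auto)
  show ?case
  proof (intro exI conjI allI)
    show "exec (While e c) m (cost e m + 1) m" by (rule exec.WhileFalse[OF WhileFalse(2)])
    show "bit_length (m a) \<le> L + 1 * K * w" for a using WhileFalse.prems(1) by (simp add: trans_le_add1)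
  qed (use e in simp)
next
  case (WhileTrue e m c t m' u m'')
  have e: "cost e m + 1 \<le> K * W\<^sup>2"
    by (rule test_cost_le[of w m L e K "1 + t + u"]) (use WhileTrue.prems WhileTrue.hyps \<open>1 \<le> w\<close> in auto)
  have s: "(1 + t + u) * K * w = K * w + t * K * w + u * K * w"
    "(1 + t + u) * K * W\<^sup>2 = K * W\<^sup>2 + t * K * W\<^sup>2 + u * K * W\<^sup>2"
    by (simp_all add: add_mult_distrib)
  have p: "ccost c \<le> K" "L + t * K * w \<le> W" "L + t * K * w + u * K * w \<le> W"
    using WhileTrue.prems(2,3) s by simp_all
  from WhileTrue.IH(1)[OF WhileTrue.prems(1) p(1,2)] obtain t1 where
    1: "exec c m t1 m'" "t1 \<le> t * K * W\<^sup>2" "\<And>a. bit_length (m' a) \<le> L + t * K * w" by blast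
  from WhileTrue.IH(2)[OF 1(3) WhileTrue.prems(2) p(3)] obtain t2 where
    2: "exec (While e c) m' t2 m''" "t2 \<le> u * K * W\<^sup>2"
       "\<And>a. bit_length (m'' a) \<le> L + t * K * w + u * K * w" by blast
  show ?case
  proof (intro exI conjI allI)
    show "exec (While e c) m (cost e m + 1 + t1 + t2) m''"
      by (rule exec.WhileTrue[OF WhileTrue.hyps(2) 1(1) 2(1)])
    show "cost e m + 1 + t1 + t2 \<le> (1 + t + u) * K * W\<^sup>2" unfolding s using e 1(2) 2(2) by linarith
    show "bit_length (m'' a) \<le> L + (1 + t + u) * K * w" for a unfolding s using 2(3)[of a] by linarith
  qed
qed

section \<open>Verification calculus for total correctness with a step bound\<close>

definition wp :: "nat \<Rightarrow> com \<Rightarrow> nat \<Rightarrow> (mem \<Rightarrow> bool) \<Rightarrow> mem \<Rightarrow> bool" where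
  "wp w c n Q m \<longleftrightarrow> (\<exists>k m'. steps w c m k m' \<and> k \<le> n \<and> Q m')"

lemma wp_mono: "wp w c n Q m \<Longrightarrow> n \<le> n' \<Longrightarrow> (\<And>m. Q m \<Longrightarrow> Q' m) \<Longrightarrow> wp w c n' Q' m"
  unfolding wp_def by (meson order_trans)

lemma wp_Skip: "Q m \<Longrightarrow> wp w Skip 1 Q m"
  unfolding wp_def using steps.Skip by blast

lemma wp_Assign:
  "ok w a m \<Longrightarrow> ok w e m \<Longrightarrow> Q (m(val a m := val e m)) \<Longrightarrow> wp w (Assign a e) 1 Q m"
  unfolding wp_def using steps.Assign by blast

lemma wp_Seq: "wp w c n (\<lambda>m'. wp w d n' Q m') m \<Longrightarrow> wp w (Seq c d) (n + n') Q m"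
  unfolding wp_def by (meson add_mono steps.Seq)

lemma wp_If:
  assumes "ok w e m" and "0 < val e m \<Longrightarrow> wp w c n Q m" and "\<not> 0 < val e m \<Longrightarrow> wp w d n Q m"
  shows "wp w (If e c d) (1 + n) Q m"
proof (cases "0 < val e m")
  case True
  with assms obtain k m' where "steps w c m k m'" "k \<le> n" "Q m'" unfolding wp_def by blast
  with True steps.IfTrue[OF assms(1)] show ?thesis unfolding wp_def by (meson add_left_mono)
next
  case False
  with assms obtain k m' where "steps w d m k m'" "k \<le> n" "Q m'" unfolding wp_def by blast
  with False steps.IfFalse[OF assms(1)] show ?thesis unfolding wp_def by (meson add_left_mono)
qed

text \<open>All loops of the program have a number of rounds known in advance. An invariant indexed
  by the round therefore replaces a termination measure and yields the step bound at once.\<close>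

lemma wp_While:
  assumes "Inv 0 m"
    and "\<And>i m. i < N \<Longrightarrow> Inv i m \<Longrightarrow> ok w e m \<and> 0 < val e m \<and> wp w c n (Inv (Suc i)) m"
    and "\<And>m. Inv N m \<Longrightarrow> ok w e m \<and> \<not> 0 < val e m"
  shows "wp w (While e c) (N * (n + 1) + 1) (Inv N) m"
proof -
  have "Inv i m \<Longrightarrow> i \<le> N \<Longrightarrow> wp w (While e c) ((N - i) * (n + 1) + 1) (Inv N) m" for i m
  proof (induction "N - i" arbitrary: i m)
    case 0
    then show ?case using assms(3)[of m] steps.WhileFalse[of w e m c] by (auto simp: wp_def)
  next
    case (Suc d)
    then have i: "i < N" by simp
    with Suc.prems assms(2) obtain k m' where
      k: "steps w c m k m'" "k \<le> n" "Inv (Suc i) m'" and e: "ok w e m" "0 < val e m"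
      unfolding wp_def by blast
    have "wp w (While e c) ((N - Suc i) * (n + 1) + 1) (Inv N) m'"
      using Suc.hyps(1)[of "Suc i" m'] Suc.hyps(2) i k by auto
    then obtain k' m'' where k': "steps w (While e c) m' k' m''" "k' \<le> (N - Suc i) * (n + 1) + 1" "Inv N m''"
      unfolding wp_def by blast
    have "N - i = Suc (N - Suc i)" using i by simp
    then have "1 + k + k' \<le> (N - i) * (n + 1) + 1" using k(2) k'(2) by simp
    with steps.WhileTrue[OF e k(1) k'(1)] k'(3) show ?case unfolding wp_def by blast
  qed
  from this[of 0 m] assms(1) show ?thesis by simp
qed

text \<open>Unrolls a loop over a range that is constant for the program, here the farmers, so that
  the index is a literal in the program text.\<close>

primrec seqs :: "(nat \<Rightarrow> com) \<Rightarrow> nat \<Rightarrow> com" where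
  "seqs f 0 = Skip"
| "seqs f (Suc k) = Seq (seqs f k) (f k)"

lemma wp_seqs:
  assumes "Inv 0 m" and "\<And>i m. i < k \<Longrightarrow> Inv i m \<Longrightarrow> wp w (f i) n (Inv (Suc i)) m"
  shows "wp w (seqs f k) (k * n + 1) (Inv k) m"
  using assms(2)
proof (induction k)
  case 0
  show ?case using wp_Skip[of "Inv 0" m w] assms(1) by simp
next
  case (Suc k)
  then have "wp w (seqs f k) (k * n + 1) (Inv k) m" by simp
  then have "wp w (seqs f k) (k * n + 1) (\<lambda>m'. wp w (f k) n (Inv (Suc k)) m') m"
    by (rule wp_mono) (use Suc.prems in auto)
  from wp_Seq[OF this] show ?case by (simp add: algebra_simps)
qed

text \<open>A test is the sign of a single expression, so a conjunction of tests is expressed by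
  nesting.\<close>

primrec ifs :: "(nat \<Rightarrow> expr) \<Rightarrow> nat \<Rightarrow> com \<Rightarrow> com" where
  "ifs f 0 c = c"
| "ifs f (Suc k) c = If (f k) (ifs f k c) Skip"

lemma wp_ifs:
  assumes "\<And>x. x < k \<Longrightarrow> ok w (f x) m"
    and "\<forall>x<k. 0 < val (f x) m \<Longrightarrow> wp w c n Q m" and "\<not> (\<forall>x<k. 0 < val (f x) m) \<Longrightarrow> Q m"
    and "1 \<le> n"
  shows "wp w (ifs f k c) (k + n) Q m"
  using assms
proof (induction k)
  case (Suc k)
  have "wp w (If (f k) (ifs f k c) Skip) (1 + (k + n)) Q m"
  proof (rule wp_If)
    show "ok w (f k) m" using Suc by simp
    show "wp w (ifs f k c) (k + n) Q m" if "0 < val (f k) m"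
      using Suc that by (auto simp: less_Suc_eq)
    show "wp w Skip (k + n) Q m" if "\<not> 0 < val (f k) m"
      using Suc that by (intro wp_mono[OF wp_Skip[of Q m]]) auto
  qed
  then show ?case by simp
qed auto

primrec esum :: "(nat \<Rightarrow> expr) \<Rightarrow> nat \<Rightarrow> expr" where
  "esum f 0 = Num 0"
| "esum f (Suc k) = Add (esum f k) (f k)"

primrec eprod :: "(nat \<Rightarrow> expr) \<Rightarrow> nat \<Rightarrow> expr" where
  "eprod f 0 = Num 1"
| "eprod f (Suc k) = Mul (eprod f k) (f k)"

lemma val_esum [simp]: "val (esum f k) m = (\<Sum>x<k. val (f x) m)"
  by (induction k) auto

lemma val_eprod [simp]: "val (eprod f k) m = (\<Prod>x<k. val (f x) m)"
  by (induction k) auto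

lemma short_esum [simp]: "short w (esum f k) m \<longleftrightarrow> (\<forall>x<k. short w (f x) m)"
  by (induction k) (auto simp: less_Suc_eq)

lemma short_eprod [simp]: "short w (eprod f k) m \<longleftrightarrow> (\<forall>x<k. short w (f x) m)"
  by (induction k) (auto simp: less_Suc_eq)

lemma ok_esum [simp]: "ok w (esum f k) m \<longleftrightarrow> (\<forall>x<k. ok w (f x) m)"
  by (induction k) (auto simp: less_Suc_eq)

lemma ok_eprodI: "(\<And>x. x < k \<Longrightarrow> ok w (f x) m \<and> short w (f x) m) \<Longrightarrow> ok w (eprod f k) m"
  by (induction k) auto

text \<open>Stores \<open>e\<close> if the cell is unset (not positive) or larger.\<close>

definition relax :: "expr \<Rightarrow> expr \<Rightarrow> com" where
  "relax a e = If (Cell a) (If (Sub (Cell a) e) (Assign a e) Skip) (Assign a e)"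

text \<open>Minimum in which a first argument that is not positive stands for infinity; this fits
  memory cells, which are 0 before their first use.\<close>

definition omin :: "int \<Rightarrow> int \<Rightarrow> int" where
  "omin x y = (if 0 < x then min x y else y)"

lemma wp_relax:
  assumes "ok w a m" "ok w e m" "Q (m(val a m := omin (m (val a m)) (val e m)))"
  shows "wp w (relax a e) 3 Q m"
proof -
  have *: "wp w (If (Sub (Cell a) e) (Assign a e) Skip) (1 + 1) Q m" if "0 < val (Cell a) m"
    using assms that by (intro wp_If wp_Assign wp_Skip) (auto simp: omin_def min_def split: if_splits)
  have "wp w (relax a e) (1 + 2) Q m"
    unfolding relax_def
  proof (intro wp_If)
    show "wp w (If (Sub (Cell a) e) (Assign a e) Skip) 2 Q m" if "0 < val (Cell a) m"
      using *[OF that] by (simp add: numeral_2_eq_2)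
    show "wp w (Assign a e) 2 Q m" if "\<not> 0 < val (Cell a) m"
      using assms that by (intro wp_mono[OF wp_Assign[of w a m e Q]]) (auto simp: omin_def)
  qed (use assms in auto)
  then show ?thesis by (simp add: numeral_3_eq_3)
qed

section \<open>Sums of digits\<close>

lemma digit_sum_bounds:
  fixes g :: "nat \<Rightarrow> int"
  assumes "\<And>x. x < K \<Longrightarrow> 0 \<le> g x \<and> g x < B"
  shows "0 \<le> (\<Sum>x<K. g x * B ^ x) \<and> (\<Sum>x<K. g x * B ^ x) < B ^ K"
  using assms
proof (induction K)
  case (Suc K)
  have "0 \<le> g K" "g K + 1 \<le> B" using Suc.prems[of K] by auto
  then have "(g K + 1) * B ^ K \<le> B * B ^ K" "0 \<le> g K * B ^ K" by (auto intro!: mult_right_mono)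
  with Suc show ?case by (auto simp: algebra_simps)
qed simp

text \<open>All digits above position \<open>y\<close>, together with the leading part
  \<open>t\<close>, are collected in \<open>u\<close>. The induction varies \<open>t\<close> because
  the top digit is absorbed into it.\<close>

lemma digit_sum_split:
  fixes g :: "nat \<Rightarrow> int"
  shows "y < K \<Longrightarrow> \<exists>u. (\<Sum>x<K. g x * B ^ x) + t * B ^ K = (\<Sum>x<y. g x * B ^ x) + B ^ y * (g y + B * u)"
proof (induction K arbitrary: t)
  case (Suc K)
  show ?case
  proof (cases "y = K")
    case True
    then show ?thesis by (intro exI[of _ t]) (simp add: algebra_simps)
  next
    case False
    with Suc.IH[of "g K + t * B"] Suc.prems show ?thesis by (simp add: algebra_simps)
  qed
qed simp

text \<open>The leading part \<open>t\<close> is unrestricted. This serves twice: accumulated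
  weights are read off a state (base \<open>B\<close>, with \<open>t\<close> the row), and owners
  are read off a value (base \<open>p\<close>, with \<open>t\<close> the cost part).\<close>

lemma digit_of_sum:
  fixes g :: "nat \<Rightarrow> int"
  assumes "\<And>x. x < K \<Longrightarrow> 0 \<le> g x \<and> g x < B" and "y < K"
  shows "((\<Sum>x<K. g x * B ^ x) + t * B ^ K) div B ^ y mod B = g y"
proof -
  obtain u where u: "(\<Sum>x<K. g x * B ^ x) + t * B ^ K = (\<Sum>x<y. g x * B ^ x) + B ^ y * (g y + B * u)"
    using digit_sum_split[OF assms(2)] by blast
  have B: "0 < B" using assms(1)[OF assms(2)] by linarith
  have "(\<Sum>x<y. g x * B ^ x) div B ^ y = 0"
    using digit_sum_bounds[of y g B] assms by (intro div_pos_pos_trivial) auto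
  then have "((\<Sum>x<K. g x * B ^ x) + t * B ^ K) div B ^ y = g y + B * u"
    unfolding u using B by simp
  with assms show ?thesis by (simp add: mod_pos_pos_trivial)
qed

text \<open>The machine has no remainder operation; the left-hand side is how the program obtains a
  digit.\<close>

lemma div_mod_diff: "0 < B \<Longrightarrow> q div B ^ y - B * (q div B ^ Suc y) = q div B ^ y mod (B :: int)"
  using zdiv_zmult2_eq[of B q "B ^ y"] minus_mult_div_eq_mod[of "q div B ^ y" B]
  by (simp add: power_Suc2 del: power_Suc)

section \<open>Dynamic programming over assignments\<close>

text \<open>The value 0 marks an empty set.\<close>

definition opt :: "int set \<Rightarrow> int \<Rightarrow> bool" where
  "opt S v \<longleftrightarrow> S = {} \<and> v = 0 \<or> v \<in> S \<and> 0 < v \<and> (\<forall>w\<in>S. v \<le> w)"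

lemma opt_union: "opt S x \<Longrightarrow> opt T y \<Longrightarrow> 0 < y \<Longrightarrow> opt (S \<union> T) (omin x y)"
  unfolding opt_def omin_def by (auto simp: min_def)

lemma opt_shift: "opt T y \<Longrightarrow> 0 < y \<Longrightarrow> 0 \<le> e \<Longrightarrow> opt ((\<lambda>w. w + e) ` T) (y + e)"
  unfolding opt_def by auto

lemma opt_zero: "opt T y \<Longrightarrow> \<not> 0 < y \<Longrightarrow> T = {}"
  unfolding opt_def by auto

text \<open>The states of row \<open>j\<close> are those reached by assigning the first \<open>j\<close> items; item \<open>j\<close>
  assigned to \<open>i\<close> moves the state by \<open>d j i\<close> at the expense \<open>c j i\<close>.\<close>

locale dp =
  fixes n p :: nat and R q0 v0 :: int and d c :: "nat \<Rightarrow> nat \<Rightarrow> int"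
  assumes rows: "j \<le> n \<Longrightarrow> (\<And>l. l < j \<Longrightarrow> a l < p) \<Longrightarrow>
      int j * R \<le> q0 + (\<Sum>l<j. d l (a l)) \<and> q0 + (\<Sum>l<j. d l (a l)) < (int j + 1) * R"
begin

definition st :: "(nat \<Rightarrow> nat) \<Rightarrow> nat \<Rightarrow> int" where
  "st a j = q0 + (\<Sum>l<j. d l (a l))"

definition vl :: "(nat \<Rightarrow> nat) \<Rightarrow> nat \<Rightarrow> int" where
  "vl a j = v0 + (\<Sum>l<j. c l (a l))"

definition valid :: "nat \<Rightarrow> (nat \<Rightarrow> nat) \<Rightarrow> bool" where
  "valid j a \<longleftrightarrow> j \<le> n \<and> (\<forall>l<j. a l < p)"

text \<open>The steps from state \<open>q\<close> along \<open>i\<close> are processed in the order of the number \<open>q * p + i\<close>;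
  \<open>S t x\<close> holds the values at \<open>x\<close> attained by the steps before the \<open>t\<close>-th.\<close>

definition S :: "int \<Rightarrow> int \<Rightarrow> int set" where
  "S t x = {vl a j |a j. valid j a \<and> st a j = x \<and> (\<forall>l. j = Suc l \<longrightarrow> st a l * int p + int (a l) < t)}"

lemma st_rows: "valid j a \<Longrightarrow> int j * R \<le> st a j \<and> st a j < (int j + 1) * R"
  unfolding valid_def st_def using rows by auto

lemma R_pos: "0 < R"
  using st_rows[of 0 "\<lambda>_. 0"] by (simp add: valid_def)

lemma row_unique:
  assumes "int j * R \<le> q" "q < (int j + 1) * R" "int j' * R \<le> q" "q < (int j' + 1) * R"
  shows "j = j'"
proof -
  have "int j * R < (int j' + 1) * R" "int j' * R < (int j + 1) * R" using assms by linarith+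
  then have "int j < int j' + 1" "int j' < int j + 1" using R_pos by (simp_all add: mult_less_cancel_right)
  then show ?thesis by linarith
qed

lemma valid_upd: "valid j a \<Longrightarrow> j < n \<Longrightarrow> i < p \<Longrightarrow> valid (Suc j) (a(j := i))"
  by (auto simp: valid_def less_Suc_eq)

lemma st_upd: "st (a(j := i)) (Suc j) = st a j + d j i" "st (a(j := i)) j = st a j"
  by (simp_all add: st_def)

lemma vl_upd: "vl (a(j := i)) (Suc j) = vl a j + c j i"
  by (simp add: vl_def)

text \<open>States are nonnegative, hence so are the numbers of all steps, and only the empty
  assignment has no last step to be excluded by \<open>t = 0\<close>.\<close>

lemma S_init: "S 0 x = (if x = q0 then {v0} else {})"
proof -
  have "\<not> st a l * int p + int (a l) < 0" if "valid (Suc l) a" for a l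
  proof -
    have "valid l a" using that by (simp add: valid_def)
    then have "0 \<le> st a l" using st_rows[of l a] R_pos by (simp add: order_trans[of 0 "int l * R"])
    then show ?thesis by (simp add: not_less)
  qed
  then have "S 0 x = {vl a 0 |a. st a 0 = x}"
    unfolding S_def by (auto simp: valid_def) (metis not0_implies_Suc)+
  then show ?thesis by (auto simp: st_def vl_def)
qed

text \<open>Exactly one step carries the number \<open>q * p + i\<close>. When it is taken, the set
  at \<open>q\<close> is already complete, because every way to reach \<open>q\<close> ends with a
  step from an earlier row; extending the members of this set gives all new values.\<close>

lemma S_step:
  assumes "j < n" "i < p" and q: "int j * R \<le> q" "q < (int j + 1) * R"
  shows "S (q * int p + int i + 1) x = S (q * int p + int i) x \<union>
    (if x = q + d j i then (\<lambda>w. w + c j i) ` S (q * int p + int i) q else {})"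
    (is "?L = ?A \<union> ?N")
proof
  show "?L \<subseteq> ?A \<union> ?N"
  proof
    fix v assume "v \<in> ?L"
    then obtain a j' where v: "v = vl a j'" and a: "valid j' a" "st a j' = x"
      and t: "\<And>l. j' = Suc l \<Longrightarrow> st a l * int p + int (a l) < q * int p + int i + 1"
      unfolding S_def by blast
    show "v \<in> ?A \<union> ?N"
    proof (cases "\<exists>l. j' = Suc l \<and> st a l * int p + int (a l) = q * int p + int i")
      case False
      then have "v \<in> ?A" unfolding S_def using v a t by force
      then show ?thesis ..
    next
      case True
      then obtain l where l: "j' = Suc l" "st a l * int p + int (a l) = q * int p + int i" by blast
      have al: "a l < p" "valid l a" using a(1) l(1) by (auto simp: valid_def)
      \<comment> \<open>Since owners are less than \<open>p\<close>, division by \<open>p\<close>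
        recovers the state from the number of a step, and then the owner.\<close>
      have "(st a l * int p + int (a l)) div int p = st a l" "(q * int p + int i) div int p = q"
        using al(1) assms(2) by (simp_all add: div_add1_eq)
      then have sq: "st a l = q" using l(2) by simp
      then have ali: "a l = i" using l(2) by simp
      have lj: "l = j" using row_unique[OF _ _ q] st_rows[OF al(2)] sq by blast
      \<comment> \<open>The predecessor of \<open>q\<close> lies in the preceding row, hence below
        \<open>q\<close>, so its steps come before all steps from \<open>q\<close>.\<close>
      have "st a l' * int p + int (a l') < q * int p + int i" if "l = Suc l'" for l'
      proof -
        have "valid l' a" "a l' < p" using al(2) that by (auto simp: valid_def)
        then have "st a l' < int l * R" using st_rows[of l' a] that by (simp add: algebra_simps)
        then have "st a l' + 1 \<le> q" using q unfolding lj by linarith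
        then have "(st a l' + 1) * int p \<le> q * int p" by (intro mult_right_mono) auto
        then show ?thesis using \<open>a l' < p\<close> by (simp add: algebra_simps)
      qed
      then have "vl a l \<in> S (q * int p + int i) q" unfolding S_def using al(2) sq by blast
      moreover have "v = vl a l + c j i" "x = q + d j i"
        using v a(2) l(1) ali lj sq by (simp_all add: vl_def st_def)
      ultimately show ?thesis by auto
    qed
  qed
  have "?A \<subseteq> ?L" unfolding S_def by force
  moreover have "?N \<subseteq> ?L"
  proof
    fix v assume "v \<in> ?N"
    then have x: "x = q + d j i" and "v \<in> (\<lambda>w. w + c j i) ` S (q * int p + int i) q"
      by (auto split: if_splits)
    then obtain a j' where v: "v = vl a j' + c j i" and a: "valid j' a" "st a j' = q"
      unfolding S_def by blast
    have j': "j' = j" using row_unique[OF _ _ q] st_rows[OF a(1)] a(2) by blast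
    have "vl (a(j := i)) (Suc j) \<in> ?L"
      unfolding S_def using valid_upd[OF a(1)[unfolded j'] assms(1,2)] a(2) st_upd[of a j i] j' x by fastforce
    then show "v \<in> ?L" using v j' by (simp add: vl_upd)
  qed
  ultimately show "?A \<union> ?N \<subseteq> ?L" by blast
qed

text \<open>The last step of a complete assignment leaves row \<open>n - 1\<close>, so its number is
  below \<open>n * R * p\<close>; the restriction in \<open>S\<close> becomes void.\<close>

lemma S_final:
  assumes "int n * R \<le> x" "x < (int n + 1) * R"
  shows "S (int n * R * int p) x = {vl a n |a. valid n a \<and> st a n = x}"
proof -
  have 1: "j = n" if "valid j a" "st a j = x" for j a
    using row_unique[OF _ _ assms] st_rows[OF that(1)] that(2) by blast
  have 2: "st a l * int p + int (a l) < int n * R * int p" if "valid n a" "n = Suc l" for a l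
  proof -
    have "valid l a" "a l < p" using that unfolding valid_def by simp_all
    then have "st a l < int n * R" using st_rows[of l a] that by (simp add: algebra_simps)
    then have "(st a l + 1) * int p \<le> int n * R * int p" by (intro mult_right_mono) auto
    then show ?thesis using \<open>a l < p\<close> by (simp add: algebra_simps)
  qed
  show ?thesis unfolding S_def using 1 2 by blast
qed

end

section \<open>Uniform blocks in lists\<close>

lemma length_concat_uniform:
  "(\<And>i. i < n \<Longrightarrow> length (f i) = l) \<Longrightarrow> length (concat (map f [0..<n])) = n * l"
  by (induction n) auto

lemma nth_concat_uniform:
  "(\<And>i. i < n \<Longrightarrow> length (f i) = l) \<Longrightarrow> i < n \<Longrightarrow> r < l \<Longrightarrow>
    concat (map f [0..<n]) ! (i * l + r) = f i ! r"
proof (induction n)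
  case (Suc n)
  have len: "length (concat (map f [0..<n])) = n * l" using Suc.prems by (intro length_concat_uniform) auto
  show ?case
  proof (cases "i = n")
    case True
    then show ?thesis by (simp add: nth_append len)
  next
    case False
    with Suc have "i < n" by simp
    then have "Suc i * l \<le> n * l" by (intro mult_le_mono1) simp
    then have "i * l + r < n * l" using Suc.prems by simp
    with Suc \<open>i < n\<close> show ?thesis by (simp add: nth_append len)
  qed
qed simp

lemma length_encode_vec [simp]: "length (encode_vec v) = 2 * dim_vec v"
  using length_concat_uniform[of "dim_vec v" "\<lambda>i. encode_rat (v $ i)" 2]
  by (simp add: encode_vec_def encode_rat_def list_of_vec_map o_def)

lemma nth_encode_vec:
  assumes "k < dim_vec v"
  shows "encode_vec v ! (2 * k) = fst (quotient_of (v $ k))"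
    "encode_vec v ! Suc (2 * k) = snd (quotient_of (v $ k))"
proof -
  have "encode_vec v = concat (map (\<lambda>i. encode_rat (v $ i)) [0..<dim_vec v])"
    by (simp add: encode_vec_def list_of_vec_map o_def)
  then show "encode_vec v ! (2 * k) = fst (quotient_of (v $ k))"
    "encode_vec v ! Suc (2 * k) = snd (quotient_of (v $ k))"
    using nth_concat_uniform[of "dim_vec v" "\<lambda>i. encode_rat (v $ i)" 2 k 0] assms
      nth_concat_uniform[of "dim_vec v" "\<lambda>i. encode_rat (v $ i)" 2 k 1]
    by (simp_all add: encode_rat_def mult.commute)
qed

lemma length_encode_mat [simp]: "length (encode_mat A) = dim_row A * dim_col A"
  unfolding encode_mat_def mat_to_list_def by (intro length_concat_uniform) simp

lemma nth_encode_mat: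
  assumes "k < dim_row A" "i < dim_col A"
  shows "encode_mat A ! (k * dim_col A + i) = A $$ (k, i)"
  unfolding encode_mat_def mat_to_list_def using assms
  by (subst nth_concat_uniform) auto

lemma load_nth: "k < length xs \<Longrightarrow> load xs (int k + 1) = xs ! k"
  by (simp add: load_def)

section \<open>Instances as dynamic programs\<close>

abbreviation "num r \<equiv> fst (quotient_of r)"
abbreviation "den r \<equiv> snd (quotient_of r)"

text \<open>Addresses are by one larger than positions in the encoding, as cell 0 holds its length.\<close>

definition "farm_at s i = 5 + i * (4 * s + 4)" for s i :: nat
definition "lots_at p s = 5 + p * (4 * s + 4)" for p s :: nat
definition "lot_len p s = s * p + 4" for p s :: nat

lemma scaled_rat:
  assumes "den r dvd D"
  shows "real_of_int (D * num r div den r) = of_int D * of_rat r"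
proof -
  have r: "r = of_int (num r) / of_int (den r)" by (rule quotient_of_div) simp
  have d: "den r > 0" by (rule quotient_of_denom_pos')
  obtain e where e: "D = den r * e" using assms by blast
  have "(of_rat r :: real) = of_int (num r) / of_int (den r)"
    by (subst r) (simp only: of_rat_divide of_rat_of_int_eq)
  moreover have "D * num r div den r = e * num r" using d e by simp
  ultimately show ?thesis using d e by simp
qed

text \<open>Rational bounds are tested by the program in the integers; multiplying out is sound
  because \<open>quotient_of\<close> returns a positive denominator.\<close>

lemma rat_le_int_iff: "r \<le> of_int k \<longleftrightarrow> num r \<le> k * den r"
  and int_le_rat_iff: "of_int k \<le> r \<longleftrightarrow> k * den r \<le> num r"
proof -
  have r: "r = of_int (num r) / of_int (den r)" by (rule quotient_of_div) simp
  have d: "(of_int (den r) :: rat) > 0" using quotient_of_denom_pos'[of r] by simp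
  have "r \<le> of_int k \<longleftrightarrow> (of_int (num r) :: rat) \<le> of_int (k * den r)"
    by (subst r) (use d in \<open>simp add: pos_divide_le_eq\<close>)
  then show "r \<le> of_int k \<longleftrightarrow> num r \<le> k * den r" by (simp only: of_int_le_iff)
  have "of_int k \<le> r \<longleftrightarrow> (of_int (k * den r) :: rat) \<le> of_int (num r)"
    by (subst r) (use d in \<open>simp add: pos_le_divide_eq\<close>)
  then show "of_int k \<le> r \<longleftrightarrow> k * den r \<le> num r" by (simp only: of_int_le_iff)
qed

text \<open>Pairs of a farmer and a feature are flattened to one index \<open>x = i * s + k\<close>,
  which numbers the digits of a state.\<close>

lemma all_pairs_iff:
  assumes "0 < (s :: nat)"
  shows "(\<forall>i<p. \<forall>k<s. Q i k) \<longleftrightarrow> (\<forall>x<p * s. Q (x div s) (x mod s))"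
proof safe
  fix x assume "\<forall>i<p. \<forall>k<s. Q i k" "x < p * s"
  then show "Q (x div s) (x mod s)" using assms by (simp add: less_mult_imp_div_less)
next
  fix i k assume *: "\<forall>x<p * s. Q (x div s) (x mod s)" "i < p" "k < s"
  have "Suc i * s \<le> p * s" using *(2) by (intro mult_le_mono1) simp
  then have "i * s + k < p * s" using *(3) by simp
  with *(1) have "Q ((i * s + k) div s) ((i * s + k) mod s)" by blast
  then show "Q i k" using *(3) by simp
qed

section \<open>Partitions as owner functions\<close>

lemma partition_owner:
  assumes "is_partition I \<pi>"
  shows "j < num_lots I \<Longrightarrow> owner I \<pi> j < num_farmers I"
    and "i < num_farmers I \<Longrightarrow> \<pi> i = {j. j < num_lots I \<and> owner I \<pi> j = i}"
proof -
  have ex: "\<exists>!i. i < num_farmers I \<and> j \<in> \<pi> i" if "j < num_lots I" for j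
  proof -
    have "j \<in> (\<Union>i<num_farmers I. \<pi> i)" using assms that by (simp add: is_partition_def)
    then obtain i where i: "i < num_farmers I" "j \<in> \<pi> i" by blast
    moreover have "i' = i" if "i' < num_farmers I" "j \<in> \<pi> i'" for i'
      using assms i that unfolding is_partition_def disjoint_family_on_def by blast
    ultimately show ?thesis by blast
  qed
  have own: "owner I \<pi> j < num_farmers I \<and> j \<in> \<pi> (owner I \<pi> j)" if "j < num_lots I" for j
    unfolding owner_def by (rule theI'[OF ex[OF that]])
  then show "j < num_lots I \<Longrightarrow> owner I \<pi> j < num_farmers I" by blast
  show "\<pi> i = {j. j < num_lots I \<and> owner I \<pi> j = i}" if i: "i < num_farmers I"
  proof -
    have "\<pi> i \<subseteq> {..<num_lots I}" using assms i by (auto simp: is_partition_def)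
    then show ?thesis using own ex i by blast
  qed
qed

definition part :: "land \<Rightarrow> (nat \<Rightarrow> nat) \<Rightarrow> nat \<Rightarrow> nat set" where
  "part I a i = {j. j < num_lots I \<and> a j = i}"

lemma
  assumes "\<And>j. j < num_lots I \<Longrightarrow> a j < num_farmers I"
  shows is_partition_part: "is_partition I (part I a)"
    and owner_part: "j < num_lots I \<Longrightarrow> owner I (part I a) j = a j"
proof -
  show "is_partition I (part I a)"
    using assms by (auto simp: is_partition_def disjoint_family_on_def part_def)
  show "j < num_lots I \<Longrightarrow> owner I (part I a) j = a j"
    unfolding owner_def part_def using assms by (intro the_equality) auto
qed

lemma sum_part:
  assumes "is_partition I \<pi>" "i < num_farmers I"
  shows "(\<Sum>j\<in>\<pi> i. h j) = (\<Sum>j<num_lots I. if i = owner I \<pi> j then h j else 0)"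
proof -
  have "\<pi> i = {..<num_lots I} \<inter> {j. i = owner I \<pi> j}" using partition_owner(2)[OF assms] by auto
  then show ?thesis by (simp add: sum.inter_restrict)
qed

text \<open>A single flag lets one proof and one program scheme cover \<open>f1\<close> and
  \<open>f3\<close>, which differ only by a constant factor for each farmer.\<close>

definition divisor :: "bool \<Rightarrow> land \<Rightarrow> nat \<Rightarrow> int" where
  "divisor weighted I i = (if weighted then orig_size I i else 1)"

definition objective :: "bool \<Rightarrow> land \<Rightarrow> (nat \<Rightarrow> nat set) \<Rightarrow> real" where
  "objective weighted I \<pi> = (\<Sum>i<num_farmers I. 1 / of_int (divisor weighted I i) *
     (\<Sum>j\<in>\<pi> i. of_int (lot_size I j) * sq_dist I i j))"

lemma objective_simps: "objective False I = f1 I" "objective True I = f3 I"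
  by (simp_all add: fun_eq_iff objective_def divisor_def f1_def f3_def)

locale land_problem =
  fixes p s M :: nat and I :: land and weighted :: bool
  assumes land_inst: "land_instance I"
    and farmers: "num_farmers I = p" and features: "num_features I = s"
    and weight_le: "j < num_lots I \<Longrightarrow> k < s \<Longrightarrow> i < p \<Longrightarrow> \<bar>weight I j $$ (k, i)\<bar> \<le> int M"
    and M_pos: "1 \<le> M"
begin

abbreviation "n \<equiv> num_lots I"
abbreviation "W l k i \<equiv> weight I l $$ (k, i)"
abbreviation "xs \<equiv> encode I"

text \<open>Until the output is decoded, the program writes only to negative addresses and behind
  the input, so this holds throughout.\<close>

definition env :: "mem \<Rightarrow> bool" where
  "env m \<longleftrightarrow> (\<forall>k\<le>length xs. m (int k) = load xs (int k))"

lemma p_pos: "0 < p" and s_pos: "0 < s" and sf: "size_feature I < s"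
  using land_inst farmers features by (auto simp: land_instance_def)

lemma weight_dim: "j < n \<Longrightarrow> dim_row (weight I j) = s \<and> dim_col (weight I j) = p"
  using land_inst farmers features by (auto simp: land_instance_def)

lemma bound_dim: "i < p \<Longrightarrow> dim_vec (lower I i) = s \<and> dim_vec (upper I i) = s"
  using land_inst farmers features by (auto simp: land_instance_def)

lemma lot_size_pos: "j < n \<Longrightarrow> 0 < lot_size I j"
  using land_inst by (auto simp: land_instance_def)

lemma orig_size_pos: "i < p \<Longrightarrow> 0 < orig_size I i"
  using land_inst farmers by (auto simp: land_instance_def)

lemma orig: "is_partition I (original I)" "feasible I (original I)"
  using land_inst by (auto simp: land_instance_def feasible_def)

lemma length_farmers: "length (concat (map (encode_farmer I) [0..<p])) = p * (4 * s + 4)"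
  by (rule length_concat_uniform) (simp add: encode_farmer_def bound_dim encode_point_def encode_rat_def)

lemma length_lots: "length (concat (map (encode_lot I) [0..<n])) = n * lot_len p s"
  by (rule length_concat_uniform)
    (simp add: encode_lot_def weight_dim encode_point_def encode_rat_def lot_len_def)

lemma length_xs: "length xs = 4 + p * (4 * s + 4) + n * lot_len p s + n"
  using length_farmers length_lots by (simp add: encode_def farmers encode_partition_def)

lemma env_nth: "env m \<Longrightarrow> k < length xs \<Longrightarrow> m (int (Suc k)) = xs ! k"
  using load_nth[of k xs] unfolding env_def by (metis Suc_leI of_nat_Suc add.commute)

section \<open>Memory addresses of the input data\<close>

lemma env_header:
  assumes m: "env m"
  shows "m 0 = int (length xs)" "m 1 = int n" "m 4 = int (size_feature I)"
proof -
  from m have "m (int 0) = load xs (int 0)" unfolding env_def by blast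
  then show "m 0 = int (length xs)" by (simp add: load_def)
  show "m 1 = int n" "m 4 = int (size_feature I)"
    using env_nth[OF m, of 0] env_nth[OF m, of 3] length_xs by (simp_all add: encode_def)
qed

lemma env_farmer:
  assumes "env m" "i < p" "r < 4 * s + 4"
  shows "m (int (farm_at s i + r)) = encode_farmer I i ! r"
proof -
  have "Suc i * (4 * s + 4) \<le> p * (4 * s + 4)" using assms by (intro mult_le_mono1) simp
  then have lt: "i * (4 * s + 4) + r < p * (4 * s + 4)" using assms by simp
  have "xs ! (4 + (i * (4 * s + 4) + r)) = concat (map (encode_farmer I) [0..<p]) ! (i * (4 * s + 4) + r)"
    using lt length_farmers by (simp add: encode_def farmers nth_append)
  also have "\<dots> = encode_farmer I i ! r"
    using assms by (intro nth_concat_uniform)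
      (simp_all add: encode_farmer_def bound_dim encode_point_def encode_rat_def)
  finally show ?thesis
    using env_nth[OF assms(1), of "4 + (i * (4 * s + 4) + r)"] lt
    by (simp add: length_xs farm_at_def algebra_simps)
qed

lemma env_bounds:
  assumes "env m" "i < p" "k < s"
  shows "m (int (farm_at s i + 2 * k)) = num (lower I i $ k)"
    "m (int (farm_at s i + (2 * k + 1))) = den (lower I i $ k)"
    "m (int (farm_at s i + (2 * s + 2 * k))) = num (upper I i $ k)"
    "m (int (farm_at s i + (2 * s + 2 * k + 1))) = den (upper I i $ k)"
  using assms by (simp_all only: env_farmer)
    (simp_all add: env_farmer encode_farmer_def nth_append nth_encode_vec bound_dim)

lemma env_farm_loc:
  assumes "env m" "i < p"
  shows "m (int (farm_at s i + 4 * s)) = num (fst (farm_loc I i))"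
    "m (int (farm_at s i + (4 * s + 1))) = den (fst (farm_loc I i))"
    "m (int (farm_at s i + (4 * s + 2))) = num (snd (farm_loc I i))"
    "m (int (farm_at s i + (4 * s + 3))) = den (snd (farm_loc I i))"
  using env_farmer[OF assms, of "4 * s"] env_farmer[OF assms, of "4 * s + 1"]
    env_farmer[OF assms, of "4 * s + 2"] env_farmer[OF assms, of "4 * s + 3"] assms(2)
  by (simp_all add: encode_farmer_def nth_append bound_dim encode_point_def encode_rat_def)

lemma env_lot:
  assumes "env m" "j < n" "r < lot_len p s"
  shows "m (int (lots_at p s + r) + int (lot_len p s) * int j) = encode_lot I j ! r"
proof -
  have "Suc j * lot_len p s \<le> n * lot_len p s" using assms by (intro mult_le_mono1) simp
  then have lt: "j * lot_len p s + r < n * lot_len p s" using assms by simp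
  have "xs ! (4 + p * (4 * s + 4) + (j * lot_len p s + r))
      = concat (map (encode_lot I) [0..<n]) ! (j * lot_len p s + r)"
    using lt length_farmers length_lots by (simp add: encode_def farmers nth_append)
  also have "\<dots> = encode_lot I j ! r"
    using assms by (intro nth_concat_uniform)
      (simp_all add: encode_lot_def weight_dim encode_point_def encode_rat_def lot_len_def)
  finally show ?thesis
    using env_nth[OF assms(1), of "4 + p * (4 * s + 4) + (j * lot_len p s + r)"] lt
    by (simp add: length_xs lots_at_def algebra_simps)
qed

lemma env_weight:
  assumes "env m" "j < n" "k < s" "i < p"
  shows "m (int (lots_at p s + (k * p + i)) + int (lot_len p s) * int j) = W j k i"
proof -
  have "Suc k * p \<le> s * p" using assms by (intro mult_le_mono1) simp
  then have lt: "k * p + i < s * p" using assms by simp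
  then show ?thesis
    using assms env_lot[of m j "k * p + i"] nth_encode_mat[of k "weight I j" i]
    by (simp add: weight_dim encode_lot_def nth_append lot_len_def)
qed

lemma env_size:
  assumes "env m" "j < n"
  shows "m (int (lots_at p s) + int p * int (size_feature I) + int (lot_len p s) * int j) = lot_size I j"
  using env_weight[OF assms sf p_pos] by (simp add: lot_size_def algebra_simps)

lemma env_lot_loc:
  assumes "env m" "j < n"
  shows "m (int (lots_at p s + s * p) + int (lot_len p s) * int j) = num (fst (lot_loc I j))"
    "m (int (lots_at p s + (s * p + 1)) + int (lot_len p s) * int j) = den (fst (lot_loc I j))"
    "m (int (lots_at p s + (s * p + 2)) + int (lot_len p s) * int j) = num (snd (lot_loc I j))"
    "m (int (lots_at p s + (s * p + 3)) + int (lot_len p s) * int j) = den (snd (lot_loc I j))"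
  using assms env_lot[of m j "s * p"] env_lot[of m j "s * p + 1"]
    env_lot[of m j "s * p + 2"] env_lot[of m j "s * p + 3"]
  by (simp_all add: encode_lot_def nth_append weight_dim encode_point_def encode_rat_def lot_len_def)

lemma env_owner:
  assumes "env m" "j < n"
  shows "m (int (lots_at p s) + int (lot_len p s) * int n + int j) = int (owner I (original I) j)"
proof -
  have "xs ! (4 + p * (4 * s + 4) + n * lot_len p s + j) = int (owner I (original I) j)"
    using length_farmers length_lots assms by (simp add: encode_def farmers nth_append encode_partition_def)
  then show ?thesis
    using env_nth[OF assms(1), of "4 + p * (4 * s + 4) + n * lot_len p s + j"] assms
    by (simp add: length_xs lots_at_def algebra_simps)
qed

lemma env_load: "env (load xs)"
  by (simp add: env_def)

subsection \<open>Integral costs\<close>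

text \<open>Every denominator is a positive entry of the input. Multiplying all positive entries
  avoids both computing a least common multiple and singling out the denominators, and the length of
  the product exceeds that of the input by a constant at most.\<close>

definition posprod :: "nat \<Rightarrow> int" where
  "posprod k = (\<Prod>a<k. if 0 < xs ! a then xs ! a else 1)"

text \<open>The original sizes are included because \<open>f3\<close> divides by them and they are
  not entries of the input.\<close>

definition D :: int where
  "D = posprod (length xs) * (\<Prod>i<p. orig_size I i)"

lemma D_pos: "0 < D"
  unfolding D_def posprod_def by (intro mult_pos_pos prod_pos) (auto simp: orig_size_pos)

lemma entry_dvd_D: "a < length xs \<Longrightarrow> 0 < xs ! a \<Longrightarrow> xs ! a dvd D"
proof -
  assume a: "a < length xs" "0 < xs ! a"
  then have "(if 0 < xs ! a then xs ! a else 1) dvd posprod (length xs)"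
    unfolding posprod_def by (intro dvd_prodI) auto
  then show ?thesis using a unfolding D_def by simp
qed

lemma cell_dvd_D:
  assumes "load xs k = v" "0 < v" "1 \<le> k" "k \<le> int (length xs)"
  shows "v dvd D"
proof -
  have "xs ! nat (k - 1) = v" using assms by (simp add: load_def)
  then show ?thesis using entry_dvd_D[of "nat (k - 1)"] assms by auto
qed

lemma farm_den_dvd: "i < p \<Longrightarrow> den (fst (farm_loc I i)) dvd D \<and> den (snd (farm_loc I i)) dvd D"
proof -
  assume i: "i < p"
  have "Suc i * (4 * s + 4) \<le> p * (4 * s + 4)" using i by (intro mult_le_mono1) simp
  then have "farm_at s i + (4 * s + 3) \<le> length xs" by (simp add: length_xs farm_at_def)
  then have "int (farm_at s i + (4 * s + 1)) \<le> int (length xs)"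
    "int (farm_at s i + (4 * s + 3)) \<le> int (length xs)" by linarith+
  then show ?thesis
    using cell_dvd_D[OF env_farm_loc(2)[OF env_load i] quotient_of_denom_pos']
      cell_dvd_D[OF env_farm_loc(4)[OF env_load i] quotient_of_denom_pos']
    by (simp add: farm_at_def)
qed

lemma lot_den_dvd: "j < n \<Longrightarrow> den (fst (lot_loc I j)) dvd D \<and> den (snd (lot_loc I j)) dvd D"
proof -
  assume j: "j < n"
  have "Suc j * lot_len p s \<le> n * lot_len p s" using j by (intro mult_le_mono1) simp
  then have "lots_at p s + (s * p + 3) + lot_len p s * j \<le> length xs"
    by (simp add: length_xs lots_at_def lot_len_def algebra_simps)
  then have "int (lots_at p s + (s * p + 3) + lot_len p s * j) \<le> int (length xs)"
    "int (lots_at p s + (s * p + 1) + lot_len p s * j) \<le> int (length xs)" by linarith+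
  then show ?thesis
    using cell_dvd_D[OF env_lot_loc(2)[OF env_load j] quotient_of_denom_pos']
      cell_dvd_D[OF env_lot_loc(4)[OF env_load j] quotient_of_denom_pos']
    by (simp add: lots_at_def)
qed

abbreviation "g \<equiv> divisor weighted I"

lemma g_pos: "i < p \<Longrightarrow> 0 < g i"
  by (simp add: divisor_def orig_size_pos)

lemma g_dvd: "i < p \<Longrightarrow> g i dvd D"
proof -
  assume "i < p"
  then have "orig_size I i dvd (\<Prod>i<p. orig_size I i)" by (intro dvd_prodI) auto
  then show ?thesis unfolding D_def divisor_def by simp
qed

definition gap_x :: "nat \<Rightarrow> nat \<Rightarrow> int" where
  "gap_x j i = D * num (fst (farm_loc I i)) div den (fst (farm_loc I i))
     - D * num (fst (lot_loc I j)) div den (fst (lot_loc I j))"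

definition gap_y :: "nat \<Rightarrow> nat \<Rightarrow> int" where
  "gap_y j i = D * num (snd (farm_loc I i)) div den (snd (farm_loc I i))
     - D * num (snd (lot_loc I j)) div den (snd (lot_loc I j))"

definition icost :: "nat \<Rightarrow> nat \<Rightarrow> int" where
  "icost j i = D div g i * (lot_size I j * (gap_x j i * gap_x j i + gap_y j i * gap_y j i))"

lemma icost_nonneg: "j < n \<Longrightarrow> i < p \<Longrightarrow> 0 \<le> icost j i"
  unfolding icost_def using D_pos g_pos[of i] lot_size_pos[of j]
  by (intro mult_nonneg_nonneg[OF _ mult_nonneg_nonneg]) (auto simp: pos_imp_zdiv_nonneg_iff)

text \<open>Two factors \<open>D\<close> clear the denominators of the squared distance, the third
  makes the division by \<open>g i\<close> integral.\<close>

lemma of_int_icost: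
  assumes "j < n" "i < p"
  shows "of_int (icost j i) = of_int D ^ 3 * (of_int (lot_size I j) * sq_dist I i j / of_int (g i))"
proof -
  let ?v = "\<lambda>f. real_of_rat (f (farm_loc I i)) - of_rat (f (lot_loc I j))"
  have gap: "of_int (gap_x j i) = of_int D * ?v fst" "of_int (gap_y j i) = of_int D * ?v snd"
    unfolding gap_x_def gap_y_def using farm_den_dvd lot_den_dvd assms
    by (simp_all add: scaled_rat algebra_simps)
  have sd: "sq_dist I i j = (?v fst)\<^sup>2 + (?v snd)\<^sup>2"
    by (simp add: sq_dist_def real_point_def norm_Pair)
  have Dg: "real_of_int (D div g i) = of_int D / of_int (g i)"
    using g_dvd[OF assms(2)] by (rule of_int_div)
  define u w where "u = ?v fst" and "w = ?v snd"
  show ?thesis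
    unfolding icost_def of_int_mult of_int_add gap sd Dg u_def[symmetric] w_def[symmetric]
    by (simp add: power2_eq_square power3_eq_cube algebra_simps add_divide_distrib)
qed

abbreviation "obj \<equiv> objective weighted I"

lemma obj_eq:
  assumes "is_partition I \<pi>"
  shows "of_int D ^ 3 * obj \<pi> = of_int (\<Sum>j<n. icost j (owner I \<pi> j))"
proof -
  have "of_int D ^ 3 * obj \<pi> = (\<Sum>i<p. \<Sum>j\<in>\<pi> i. of_int (icost j i))"
  proof -
    have "of_int D ^ 3 * (1 / of_int (g i) * (\<Sum>j\<in>\<pi> i. of_int (lot_size I j) * sq_dist I i j))
        = (\<Sum>j\<in>\<pi> i. of_int (icost j i))" if "i < p" for i
    proof -
      have "j < n" if "j \<in> \<pi> i" for j using partition_owner(2)[OF assms] that \<open>i < p\<close> farmers by auto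
      then have "(\<Sum>j\<in>\<pi> i. real_of_int (icost j i))
          = (\<Sum>j\<in>\<pi> i. of_int D ^ 3 * (of_int (lot_size I j) * sq_dist I i j / of_int (g i)))"
        using \<open>i < p\<close> by (intro sum.cong) (auto simp: of_int_icost)
      then show ?thesis by (simp add: sum_distrib_left)
    qed
    then show ?thesis unfolding objective_def farmers by (subst sum_distrib_left) (intro sum.cong, auto)
  qed
  also have "\<dots> = (\<Sum>i<p. \<Sum>j<n. if i = owner I \<pi> j then of_int (icost j i) else 0)"
    by (rule sum.cong[OF refl], subst sum_part[OF assms]) (use farmers in auto)
  also have "\<dots> = (\<Sum>j<n. \<Sum>i<p. if i = owner I \<pi> j then of_int (icost j i) else 0)"
    by (rule sum.swap)
  also have "\<dots> = (\<Sum>j<n. of_int (icost j (owner I \<pi> j)))"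
    using partition_owner(1)[OF assms] farmers by (intro sum.cong) (auto simp: sum.delta)
  finally show ?thesis by simp
qed

subsection \<open>States\<close>

abbreviation "K \<equiv> p * s"

text \<open>A sum of at most \<open>n\<close> entries lies between \<open>- n * M\<close> and
  \<open>n * M\<close>. The offset \<open>n * M\<close>, added once in \<open>start\<close>, turns
  it into a digit between 0 and \<open>B - 1\<close>, so negative weights do no harm.\<close>

definition B :: int where "B = 2 * int M * int n + 1"

definition R :: int where "R = B ^ K"

definition wsum :: "(nat \<Rightarrow> nat) \<Rightarrow> nat \<Rightarrow> nat \<Rightarrow> int" where
  "wsum a j x = (\<Sum>l<j. if x div s = a l then W l (x mod s) (x div s) else 0)"

definition shift :: "nat \<Rightarrow> nat \<Rightarrow> int" where
  "shift j i = R + (\<Sum>x<K. (if x div s = i then W j (x mod s) i else 0) * B ^ x)"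

definition start :: int where
  "start = (\<Sum>x<K. int n * int M * B ^ x)"

definition P :: int where "P = int p ^ n"

definition expense :: "nat \<Rightarrow> nat \<Rightarrow> int" where
  "expense j i = P * icost j i + int i * int p ^ j"

lemma state_eq: "start + (\<Sum>l<j. shift l (a l)) = (\<Sum>x<K. (int n * int M + wsum a j x) * B ^ x) + int j * R"
proof (induction j)
  case 0
  show ?case by (simp add: start_def wsum_def)
next
  case (Suc j)
  have "(\<Sum>x<K. (int n * int M + wsum a (Suc j) x) * B ^ x)
      = (\<Sum>x<K. (int n * int M + wsum a j x) * B ^ x)
        + (\<Sum>x<K. (if x div s = a j then W j (x mod s) (a j) else 0) * B ^ x)"
    unfolding sum.distrib[symmetric] by (intro sum.cong) (auto simp: wsum_def algebra_simps)
  then show ?case using Suc.IH by (simp add: shift_def algebra_simps)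
qed

lemma wsum_digit:
  assumes "j \<le> n" "x < K"
  shows "0 \<le> int n * int M + wsum a j x \<and> int n * int M + wsum a j x < B"
proof -
  have "\<bar>wsum a j x\<bar> \<le> (\<Sum>l<j. \<bar>if x div s = a l then W l (x mod s) (x div s) else 0\<bar>)"
    unfolding wsum_def by (rule sum_abs)
  also have "\<dots> \<le> (\<Sum>l<j. int M)"
  proof (intro sum_mono)
    fix l assume "l \<in> {..<j}"
    then have *: "\<bar>W l (x mod s) (x div s)\<bar> \<le> int M"
      using assms s_pos by (intro weight_le) (auto simp: less_mult_imp_div_less)
    show "\<bar>if x div s = a l then W l (x mod s) (x div s) else 0\<bar> \<le> int M"
    proof (cases "x div s = a l")
      case True
      show ?thesis unfolding if_P[OF True] by (rule *)
    qed simp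
  qed
  also have "\<dots> \<le> int n * int M" using assms(1) by (simp add: mult_right_mono)
  finally have "\<bar>wsum a j x\<bar> \<le> int n * int M" .
  moreover have "B = 2 * (int n * int M) + 1" by (simp add: B_def)
  ultimately show ?thesis by linarith
qed

lemma B_pos: "0 < B" and R_ge: "0 < R" and P_pos: "0 < P"
  using p_pos by (simp_all add: B_def R_def P_def add_pos_nonneg pos_add_strict)

lemma state_rows:
  assumes "j \<le> n"
  shows "int j * R \<le> start + (\<Sum>l<j. shift l (a l)) \<and> start + (\<Sum>l<j. shift l (a l)) < (int j + 1) * R"
  using digit_sum_bounds[of K "\<lambda>x. int n * int M + wsum a j x" B] wsum_digit[OF assms]
  unfolding state_eq by (simp add: R_def algebra_simps)

text \<open>The value of the empty assignment is \<open>P\<close> instead of 0, so that attained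
  values are positive even at cost 0 and cannot be confused with the mark of an empty set.\<close>

sublocale dp n p R start P shift expense
  by unfold_locales (rule state_rows)

definition feas_state :: "int \<Rightarrow> bool" where
  "feas_state q \<longleftrightarrow> (\<forall>x<K.
     num (lower I (x div s) $ (x mod s)) \<le>
       (q div B ^ x mod B - int n * int M) * den (lower I (x div s) $ (x mod s)) \<and>
     (q div B ^ x mod B - int n * int M) * den (upper I (x div s) $ (x mod s)) \<le>
       num (upper I (x div s) $ (x mod s)))"

lemma feasible_iff: "feasible I \<pi> \<longleftrightarrow> is_partition I \<pi> \<and> feas_state (st (owner I \<pi>) n)"
proof (cases "is_partition I \<pi>")
  case True
  have "st (owner I \<pi>) n div B ^ x mod B = int n * int M + wsum (owner I \<pi>) n x" if "x < K" for x
    unfolding st_def state_eq R_def using that by (intro digit_of_sum wsum_digit) auto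
  then have "feas_state (st (owner I \<pi>) n) \<longleftrightarrow> (\<forall>x<K.
      lower I (x div s) $ (x mod s) \<le> of_int (wsum (owner I \<pi>) n x) \<and>
      of_int (wsum (owner I \<pi>) n x) \<le> upper I (x div s) $ (x mod s))"
    unfolding feas_state_def by (simp add: rat_le_int_iff int_le_rat_iff)
  moreover have "wsum (owner I \<pi>) n x = (\<Sum>j\<in>\<pi> (x div s). W j (x mod s) (x div s))" if "x < K" for x
    unfolding wsum_def
    by (subst sum_part[OF True]) (use that farmers in \<open>auto simp: less_mult_imp_div_less\<close>)
  ultimately show ?thesis
    unfolding feasible_def farmers features all_pairs_iff[OF s_pos] using True by auto
qed (simp add: feasible_def)

lemma code_bounds:
  "valid n a \<Longrightarrow> 0 \<le> (\<Sum>l<n. int (a l) * int p ^ l) \<and> (\<Sum>l<n. int (a l) * int p ^ l) < P"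
  unfolding P_def by (intro digit_sum_bounds) (auto simp: valid_def)

lemma vl_eq: "vl a n = (\<Sum>l<n. int (a l) * int p ^ l) + (1 + (\<Sum>l<n. icost l (a l))) * P"
  by (simp add: vl_def expense_def sum.distrib sum_distrib_left[symmetric] algebra_simps)

lemma vl_digit: "valid n a \<Longrightarrow> j < n \<Longrightarrow> vl a n div int p ^ j mod int p = int (a j)"
  unfolding vl_eq unfolding P_def by (intro digit_of_sum) (auto simp: valid_def)

lemma minimal_value:
  assumes a: "valid n a" "feas_state (st a n)"
    and min: "\<And>b. valid n b \<Longrightarrow> feas_state (st b n) \<Longrightarrow> vl a n \<le> vl b n"
  shows "is_arg_min obj (feasible I) (part I a)"
proof -
  have part: "is_partition I (part I a)" and own: "\<And>j. j < n \<Longrightarrow> owner I (part I a) j = a j"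
    using is_partition_part[of I a] owner_part[of I a] a(1) farmers by (auto simp: valid_def)
  have "st (owner I (part I a)) n = st a n" using own by (simp add: st_def)
  then have "feasible I (part I a)" using feasible_iff part a(2) by simp
  moreover have "obj (part I a) \<le> obj \<pi>" if "feasible I \<pi>" for \<pi>
  proof -
    let ?b = "owner I \<pi>"
    have \<pi>: "is_partition I \<pi>" "feas_state (st ?b n)" using that feasible_iff by auto
    have b: "valid n ?b" using partition_owner(1)[OF \<pi>(1)] farmers by (simp add: valid_def)
    let ?c = "\<lambda>a. \<Sum>l<n. icost l (a l)"
    \<comment> \<open>Both owner codes lie between 0 and \<open>P - 1\<close>, so they can only
      decide between equal costs; the additional 1 on the right makes up for the code of
      \<open>?b\<close>.\<close>
    have "(1 + ?c a) * P < (1 + ?c ?b + 1) * P"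
      using min[OF b \<pi>(2)] code_bounds[OF a(1)] code_bounds[OF b] unfolding vl_eq
      by (simp add: algebra_simps)
    then have "?c a \<le> ?c ?b" using P_pos by (simp add: mult_less_cancel_right)
    moreover have "?c (owner I (part I a)) = ?c a" using own by simp
    ultimately have "of_int D ^ 3 * obj (part I a) \<le> of_int D ^ 3 * obj \<pi>"
      unfolding obj_eq[OF part] obj_eq[OF \<pi>(1)] of_int_le_iff by simp
    then show ?thesis using D_pos by (simp add: mult_le_cancel_left)
  qed
  ultimately show ?thesis unfolding is_arg_min_def by (auto simp: not_less)
qed

end

section \<open>The program\<close>

lemma wp_Seq':
  assumes "wp w c n Q' m" and "\<And>m'. Q' m' \<Longrightarrow> wp w d n' Q m'"
  shows "wp w (Seq c d) (n + n') Q m"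
  by (rule wp_Seq, rule wp_mono[OF assms(1)]) (use assms(2) in auto)

text \<open>The variables are kept at negative addresses, the size of farmer \<open>i\<close>'s original lots at
  \<open>- 10 - i\<close>, and the value at state \<open>q\<close> at the \<open>q\<close>-th address behind the input.\<close>

abbreviation "Var x \<equiv> Cell (Num x)"
abbreviation "vN \<equiv> Var 1"
abbreviation "vD \<equiv> Var (- 1)"
abbreviation "vP \<equiv> Var (- 2)"
abbreviation "vE \<equiv> Var (- 3)"
abbreviation "vJ \<equiv> Var (- 4)"
abbreviation "vQ \<equiv> Var (- 5)"
abbreviation "vBest \<equiv> Var (- 6)"

definition table :: "expr \<Rightarrow> expr" where
  "table e = Add (Add (Var 0) (Num 1)) e"

definition lot_cell :: "nat \<Rightarrow> nat \<Rightarrow> expr \<Rightarrow> expr" where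
  "lot_cell p s r = Cell (Add r (Mul (Num (int (lot_len p s))) vJ))"

definition size_expr :: "nat \<Rightarrow> nat \<Rightarrow> expr" where
  "size_expr p s = lot_cell p s (Add (Num (int (lots_at p s))) (Mul (Num (int p)) (Var 4)))"

definition owner_expr :: "nat \<Rightarrow> nat \<Rightarrow> expr" where
  "owner_expr p s =
     Cell (Add (Add (Num (int (lots_at p s))) (Mul (Num (int (lot_len p s))) vN)) vJ)"

definition base_expr :: "nat \<Rightarrow> expr" where
  "base_expr M = Add (Mul (Num (2 * int M)) vN) (Num 1)"

text \<open>The exponent is a constant of the program, so the power is written out as a product. It
  reads only cell 1 and is therefore \<open>short\<close>, and no variable is spent on it.\<close>

definition power_expr :: "nat \<Rightarrow> nat \<Rightarrow> expr" where
  "power_expr M k = eprod (\<lambda>_. base_expr M) k"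

text \<open>The offset \<open>r\<close> is 0 for the first coordinate and 2 for the second, as each
  coordinate occupies a numerator and a denominator. The divisions are exact when \<open>vD\<close>
  holds \<open>D\<close>.\<close>

definition gap_expr :: "nat \<Rightarrow> nat \<Rightarrow> nat \<Rightarrow> nat \<Rightarrow> expr" where
  "gap_expr p s r i = Sub
     (Div (Mul vD (Var (int (farm_at s i + (4 * s + r))))) (Var (int (farm_at s i + (4 * s + r + 1)))))
     (Div (Mul vD (lot_cell p s (Num (int (lots_at p s + (s * p + r))))))
        (lot_cell p s (Num (int (lots_at p s + (s * p + r + 1))))))"

text \<open>The possibly long cells \<open>vP\<close> and \<open>vE\<close> each occur once,
  multiplied by a short expression.\<close>

definition expense_expr :: "bool \<Rightarrow> nat \<Rightarrow> nat \<Rightarrow> nat \<Rightarrow> expr" where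
  "expense_expr weighted p s i = Add
     (Mul vP (Mul (Div vD (if weighted then Var (- 10 - int i) else Num 1))
       (Mul (size_expr p s) (Add (Mul (gap_expr p s 0 i) (gap_expr p s 0 i))
          (Mul (gap_expr p s 2 i) (gap_expr p s 2 i))))))
     (Mul (Num (int i)) vE)"

definition shift_expr :: "nat \<Rightarrow> nat \<Rightarrow> nat \<Rightarrow> nat \<Rightarrow> expr" where
  "shift_expr p s M i = Add (power_expr M (p * s))
     (esum (\<lambda>x. if x div s = i
        then Mul (lot_cell p s (Num (int (lots_at p s + (x mod s * p + i))))) (power_expr M x)
        else Num 0) (p * s))"

definition start_expr :: "nat \<Rightarrow> nat \<Rightarrow> nat \<Rightarrow> expr" where
  "start_expr p s M = esum (\<lambda>x. Mul (Mul vN (Num (int M))) (power_expr M x)) (p * s)"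

definition sum_expr :: "nat \<Rightarrow> nat \<Rightarrow> expr" where
  "sum_expr M x = Sub
     (Sub (Div vQ (power_expr M x)) (Mul (base_expr M) (Div vQ (power_expr M (Suc x)))))
     (Mul vN (Num (int M)))"

text \<open>Adding 1 turns a weak inequality between integers into the positivity that a test can
  check.\<close>

definition lower_expr :: "nat \<Rightarrow> nat \<Rightarrow> nat \<Rightarrow> expr" where
  "lower_expr s M x = Add (Sub
     (Mul (sum_expr M x) (Var (int (farm_at s (x div s) + (2 * (x mod s) + 1)))))
     (Var (int (farm_at s (x div s) + 2 * (x mod s))))) (Num 1)"

definition upper_expr :: "nat \<Rightarrow> nat \<Rightarrow> nat \<Rightarrow> expr" where
  "upper_expr s M x = Add (Sub
     (Var (int (farm_at s (x div s) + (2 * s + 2 * (x mod s)))))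
     (Mul (sum_expr M x) (Var (int (farm_at s (x div s) + (2 * s + 2 * (x mod s) + 1)))))) (Num 1)"

text \<open>The counter and the accumulators of the sizes rely on cells being 0 initially. The same
  loop builds \<open>p ^ n\<close> at address -2.\<close>

definition sizes_com :: "nat \<Rightarrow> nat \<Rightarrow> com" where
  "sizes_com p s = Seq (Assign (Num (- 2)) (Num 1)) (While (Sub vN vJ)
     (Seq (Assign (Sub (Num (- 10)) (owner_expr p s))
         (Add (Cell (Sub (Num (- 10)) (owner_expr p s))) (size_expr p s)))
       (Seq (Assign (Num (- 2)) (Mul vP (Num (int p)))) (Assign (Num (- 4)) (Add vJ (Num 1))))))"

definition scale_com :: "nat \<Rightarrow> com" where
  "scale_com p = Seq (Assign (Num (- 1)) (Num 1)) (Seq (Assign (Num (- 4)) (Num 0))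
     (Seq (While (Sub (Var 0) vJ)
         (Seq (Assign (Num (- 4)) (Add vJ (Num 1)))
           (If (Cell vJ) (Assign (Num (- 1)) (Mul vD (Cell vJ))) Skip)))
       (Assign (Num (- 1)) (Mul vD (eprod (\<lambda>i. Var (- 10 - int i)) p)))))"

definition edge_com :: "bool \<Rightarrow> nat \<Rightarrow> nat \<Rightarrow> nat \<Rightarrow> nat \<Rightarrow> com" where
  "edge_com weighted p s M i = If (Cell (table vQ))
     (relax (table (Add vQ (shift_expr p s M i))) (Add (Cell (table vQ)) (expense_expr weighted p s i))) Skip"

text \<open>\<open>vQ\<close> is never reset: it starts at 0 and runs on through the rows, which are
  consecutive intervals. All states of a row are visited, whether reached or not.\<close>

definition row_com :: "bool \<Rightarrow> nat \<Rightarrow> nat \<Rightarrow> nat \<Rightarrow> com" where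
  "row_com weighted p s M = While (Sub (Mul (Add vJ (Num 1)) (power_expr M (p * s))) vQ)
     (Seq (seqs (edge_com weighted p s M) p) (Assign (Num (- 5)) (Add vQ (Num 1))))"

definition rows_com :: "bool \<Rightarrow> nat \<Rightarrow> nat \<Rightarrow> nat \<Rightarrow> com" where
  "rows_com weighted p s M = Seq (Assign (Num (- 3)) (Num 1)) (Seq (Assign (Num (- 4)) (Num 0))
     (Seq (Assign (table (start_expr p s M)) vP)
       (While (Sub vN vJ) (Seq (row_com weighted p s M)
         (Seq (Assign (Num (- 4)) (Add vJ (Num 1))) (Assign (Num (- 3)) (Mul vE (Num (int p)))))))))"

definition select_com :: "nat \<Rightarrow> nat \<Rightarrow> nat \<Rightarrow> com" where
  "select_com p s M = While (Sub (Mul (Add vN (Num 1)) (power_expr M (p * s))) vQ)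
     (Seq (ifs (lower_expr s M) (p * s) (ifs (upper_expr s M) (p * s)
         (If (Cell (table vQ)) (relax (Num (- 6)) (Cell (table vQ))) Skip)))
       (Assign (Num (- 5)) (Add vQ (Num 1))))"

text \<open>The first output entry overwrites cell 1, where the number of lots is held, so this
  number is moved to address -1 beforehand.\<close>

definition decode_com :: "nat \<Rightarrow> com" where
  "decode_com p = Seq (Assign (Num (- 1)) vN) (Seq (Assign (Num (- 4)) (Num 0))
     (Seq (While (Sub vD vJ)
         (Seq (Assign (Num (- 4)) (Add vJ (Num 1)))
           (Seq (Assign vJ (Sub vBest (Mul (Num (int p)) (Div vBest (Num (int p))))))
             (Assign (Num (- 6)) (Div vBest (Num (int p)))))))
       (Assign (Num 0) vD)))"

definition solve_com :: "bool \<Rightarrow> nat \<Rightarrow> nat \<Rightarrow> nat \<Rightarrow> com" where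
  "solve_com weighted p s M = Seq (sizes_com p s) (Seq (scale_com p)
     (Seq (rows_com weighted p s M) (Seq (select_com p s M) (decode_com p))))"

section \<open>Correctness of the program\<close>

lemma val_base_power [simp]:
  "val (power_expr M k) m = val (base_expr M) m ^ k"
  by (simp add: power_expr_def)

lemma short_power [simp]: "short w (power_expr M k) m \<longleftrightarrow> k = 0 \<or> short w (base_expr M) m"
  by (auto simp: power_expr_def)

text \<open>These are the only quantities that must be short. Nothing is assumed about the length of
  \<open>P\<close>, the states or the table values.\<close>

locale land_program = land_problem +
  fixes w :: nat
  assumes short_input: "k \<le> length xs \<Longrightarrow> bit_length (load xs (int k)) \<le> w"
    and short_D: "bit_length D \<le> w"
    and short_size: "i < p \<Longrightarrow> bit_length (orig_size I i) \<le> w"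
begin

section \<open>Values and admissibility of the expressions in the program\<close>

lemma env_short: "env m \<Longrightarrow> 0 \<le> a \<Longrightarrow> a \<le> int (length xs) \<Longrightarrow> bit_length (m a) \<le> w"
  using short_input[of "nat a"] unfolding env_def by (metis int_nat_eq nat_le_iff)

lemma env_upd: "env m \<Longrightarrow> a < 0 \<or> int (length xs) < a \<Longrightarrow> env (m(a := v))"
  by (auto simp: env_def)

lemma farm_address:
  assumes "i < p" "r < 4 * s + 4"
  shows "int (farm_at s i + r) \<le> int (length xs)"
proof -
  have "Suc i * (4 * s + 4) \<le> p * (4 * s + 4)" using assms by (intro mult_le_mono1) simp
  then have "farm_at s i + r \<le> length xs" using assms by (simp add: length_xs farm_at_def)
  then show ?thesis by simp
qed

lemma lot_address:
  assumes "j < n" "r < lot_len p s"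
  shows "int (lots_at p s + r) + int (lot_len p s) * int j \<le> int (length xs)"
proof -
  have "Suc j * lot_len p s \<le> n * lot_len p s" using assms by (intro mult_le_mono1) simp
  then have "lots_at p s + r + lot_len p s * j \<le> length xs"
    using assms by (simp add: length_xs lots_at_def algebra_simps)
  then have "int (lots_at p s + r + lot_len p s * j) \<le> int (length xs)" by (simp only: of_nat_le_iff)
  then show ?thesis by (simp only: of_nat_add of_nat_mult)
qed

lemma weight_index: "k < s \<Longrightarrow> i < p \<Longrightarrow> k * p + i < s * p"
  using mult_le_mono1[of "Suc k" s p] by simp

lemma header_short:
  assumes "env m"
  shows "short w vN m" "short w (Var 4) m"
  using env_short[OF assms, of 1] env_short[OF assms, of 4] by (simp_all add: length_xs)

lemma base_expr_val:
  assumes "env m"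
  shows "val (base_expr M) m = B" "short w (base_expr M) m" "ok w (base_expr M) m"
    "ok w (power_expr M k) m"
  using env_header[OF assms] header_short[OF assms]
  by (auto simp: base_expr_def B_def power_expr_def intro!: ok_eprodI)

lemma size_expr_val:
  assumes "env m" "m (- 4) = int j" "j < n"
  shows "val (size_expr p s) m = lot_size I j" "short w (size_expr p s) m" "ok w (size_expr p s) m"
proof -
  show *: "val (size_expr p s) m = lot_size I j"
    using env_size[OF assms(1,3)] env_header[OF assms(1)] assms(2)
    by (simp add: size_expr_def lot_cell_def)
  have "size_feature I * p < lot_len p s" using weight_index[OF sf p_pos] unfolding lot_len_def by linarith
  then have "int (lots_at p s + size_feature I * p) + int (lot_len p s) * int j \<le> int (length xs)"
    using assms(3) by (intro lot_address)
  then show "short w (size_expr p s) m"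
    using env_header[OF assms(1)] assms(2)
    by (auto simp: size_expr_def lot_cell_def mult.commute intro!: env_short[OF assms(1)])
  show "ok w (size_expr p s) m" by (simp add: size_expr_def lot_cell_def)
qed

lemma owner_expr_val:
  assumes "env m" "m (- 4) = int j" "j < n"
  shows "val (owner_expr p s) m = int (owner I (original I) j)" "ok w (owner_expr p s) m"
  using env_owner[OF assms(1,3)] env_header[OF assms(1)] assms(2)
  by (simp_all add: owner_expr_def)

lemma gap_expr_val:
  assumes "env m" "m (- 4) = int j" "j < n" "i < p" "m (- 1) = D"
  shows "val (gap_expr p s 0 i) m = gap_x j i" "val (gap_expr p s 2 i) m = gap_y j i"
    "r < 3 \<Longrightarrow> short w (gap_expr p s r i) m" "r < 3 \<Longrightarrow> ok w (gap_expr p s r i) m"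
proof -
  show "val (gap_expr p s 0 i) m = gap_x j i" "val (gap_expr p s 2 i) m = gap_y j i"
    using env_farm_loc[OF assms(1,4)] env_lot_loc[OF assms(1,3)] assms(2,5)
    by (simp_all add: gap_expr_def lot_cell_def gap_x_def gap_y_def algebra_simps)
  have farm: "bit_length (m (int (farm_at s i + r))) \<le> w" if "r < 4 * s + 4" for r
    using farm_address[OF assms(4) that] by (intro env_short[OF assms(1)]) auto
  have lot: "bit_length (m (int (lots_at p s + r) + int (lot_len p s) * int j)) \<le> w"
    if "r < lot_len p s" for r
    using lot_address[OF assms(3) that] by (intro env_short[OF assms(1)]) auto
  show "short w (gap_expr p s r i) m" "ok w (gap_expr p s r i) m" if "r < 3"
    using that assms(2,5) short_D farm[of "4 * s + r"] farm[of "4 * s + r + 1"]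
      lot[of "s * p + r"] lot[of "s * p + r + 1"]
    by (simp_all add: gap_expr_def lot_cell_def lot_len_def)
qed

lemma expense_expr_val:
  assumes "env m" "m (- 4) = int j" "j < n" "i < p" "m (- 1) = D" "m (- 2) = P"
    "m (- 3) = int p ^ j" "m (- 10 - int i) = orig_size I i"
  shows "val (expense_expr weighted p s i) m = expense j i" "ok w (expense_expr weighted p s i) m"
  using gap_expr_val[OF assms(1-5)] size_expr_val[OF assms(1-3)] assms(5-8) short_D short_size[OF assms(4)]
  by (auto simp: expense_expr_def expense_def icost_def divisor_def)

lemma shift_expr_val:
  assumes "env m" "m (- 4) = int j" "j < n" "i < p"
  shows "val (shift_expr p s M i) m = shift j i" "ok w (shift_expr p s M i) m"
proof -
  have "(if x div s = i then m (int (lots_at p s + (x mod s * p + i)) + int (lot_len p s) * int j) * B ^ x else 0)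
    = (if x div s = i then W j (x mod s) i else 0) * B ^ x" for x
    using env_weight[OF assms(1,3) _ assms(4), of "x mod s"] s_pos by simp
  then show "val (shift_expr p s M i) m = shift j i"
    using base_expr_val[OF assms(1)] assms(2)
    by (simp add: shift_expr_def shift_def R_def lot_cell_def if_distrib[of "\<lambda>e. val e m"]
      cong: if_cong del: of_nat_add)
  show "ok w (shift_expr p s M i) m"
    using base_expr_val[OF assms(1)] by (auto simp: shift_expr_def lot_cell_def)
qed

lemma start_expr_val:
  assumes "env m"
  shows "val (start_expr p s M) m = start" "ok w (start_expr p s M) m"
  using base_expr_val[OF assms] env_header[OF assms] header_short[OF assms]
  by (auto simp: start_expr_def start_def)

lemma sum_expr_val:
  assumes "env m"
  shows "val (sum_expr M x) m = m (- 5) div B ^ x mod B - int n * int M" "ok w (sum_expr M x) m"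
  using base_expr_val[OF assms] env_header[OF assms] header_short[OF assms] div_mod_diff[OF B_pos, of "m (- 5)" x]
  by (simp_all add: sum_expr_def)

lemma feas_exprs:
  assumes "env m" "m (- 5) = q"
  shows "feas_state q \<longleftrightarrow> (\<forall>x<K. 0 < val (lower_expr s M x) m) \<and> (\<forall>x<K. 0 < val (upper_expr s M x) m)"
    "x < K \<Longrightarrow> ok w (lower_expr s M x) m" "x < K \<Longrightarrow> ok w (upper_expr s M x) m"
proof -
  have idx: "x div s < p" "x mod s < s" if "x < K" for x
    using that s_pos by (simp_all add: less_mult_imp_div_less)
  have "0 < val (lower_expr s M x) m \<longleftrightarrow> num (lower I (x div s) $ (x mod s)) \<le>
       (q div B ^ x mod B - int n * int M) * den (lower I (x div s) $ (x mod s))"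
    "0 < val (upper_expr s M x) m \<longleftrightarrow>
     (q div B ^ x mod B - int n * int M) * den (upper I (x div s) $ (x mod s)) \<le>
       num (upper I (x div s) $ (x mod s))" if "x < K" for x
    unfolding lower_expr_def upper_expr_def val.simps sum_expr_val(1)[OF assms(1)] assms(2)
      env_bounds[OF assms(1) idx[OF that]] by auto
  then show "feas_state q \<longleftrightarrow> (\<forall>x<K. 0 < val (lower_expr s M x) m) \<and> (\<forall>x<K. 0 < val (upper_expr s M x) m)"
    unfolding feas_state_def by auto
  have farm: "bit_length (m (int (farm_at s (x div s) + r))) \<le> w" if "r < 4 * s + 4" "x < K" for r x
    using farm_address[OF idx(1)[OF that(2)] that(1)] by (intro env_short[OF assms(1)]) auto
  show "x < K \<Longrightarrow> ok w (lower_expr s M x) m" "x < K \<Longrightarrow> ok w (upper_expr s M x) m"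
    using sum_expr_val(2)[OF assms(1)] idx[of x] farm[of "2 * (x mod s) + 1" x]
      farm[of "2 * s + 2 * (x mod s) + 1" x]
    by (simp_all add: lower_expr_def upper_expr_def)
qed

end

section \<open>Invariants and step counts of the phases of the program\<close>

context land_program begin

abbreviation "len \<equiv> length xs"

text \<open>The first clause also keeps the variables not yet used and the whole table at 0, as the
  later phases require.\<close>

definition sizes_inv :: "nat \<Rightarrow> mem \<Rightarrow> bool" where
  "sizes_inv j m \<longleftrightarrow> (\<forall>a. - 10 < a \<and> a \<noteq> - 2 \<and> a \<noteq> - 4 \<longrightarrow> m a = load xs a) \<and>
     m (- 2) = int p ^ j \<and> m (- 4) = int j \<and>
     (\<forall>i<p. m (- 10 - int i) = (\<Sum>l<j. if i = owner I (original I) l then lot_size I l else 0))"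

lemma orig_size_sum: "i < p \<Longrightarrow>
    orig_size I i = (\<Sum>l<n. if i = owner I (original I) l then lot_size I l else 0)"
  unfolding orig_size_def using orig(1) farmers by (intro sum_part) auto

lemma orig_owner: "l < n \<Longrightarrow> owner I (original I) l < p"
  using partition_owner(1)[OF orig(1)] farmers by simp

lemma wp_sizes: "wp w (sizes_com p s) (1 + (n * (1 + (1 + 1) + 1) + 1)) (sizes_inv n) (load xs)"
  unfolding sizes_com_def
proof (rule wp_Seq', rule wp_Assign)
  show "sizes_inv 0 ((load xs)(val (Num (- 2)) (load xs) := val (Num 1) (load xs)))"
    by (auto simp: sizes_inv_def load_def)
  fix m assume m: "sizes_inv 0 m"
  have env: "env m" if "sizes_inv j m" for j m
    using that by (auto simp: sizes_inv_def env_def)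
  show "wp w (While (Sub vN vJ)
     (Seq (Assign (Sub (Num (- 10)) (owner_expr p s))
         (Add (Cell (Sub (Num (- 10)) (owner_expr p s))) (size_expr p s)))
       (Seq (Assign (Num (- 2)) (Mul vP (Num (int p)))) (Assign (Num (- 4)) (Add vJ (Num 1))))))
     (n * (1 + (1 + 1) + 1) + 1) (sizes_inv n) m"
  proof (rule wp_While[where Inv = sizes_inv])
    fix j m assume j: "j < n" and inv: "sizes_inv j m"
    note e = env[OF inv]
    have J: "m (- 4) = int j" using inv by (simp add: sizes_inv_def)
    show "ok w (Sub vN vJ) m \<and> 0 < val (Sub vN vJ) m \<and>
      wp w (Seq (Assign (Sub (Num (- 10)) (owner_expr p s))
         (Add (Cell (Sub (Num (- 10)) (owner_expr p s))) (size_expr p s)))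
       (Seq (Assign (Num (- 2)) (Mul vP (Num (int p)))) (Assign (Num (- 4)) (Add vJ (Num 1)))))
       (1 + (1 + 1)) (sizes_inv (Suc j)) m"
    proof (intro conjI wp_Seq wp_Assign)
      show "0 < val (Sub vN vJ) m" using env_header(2)[OF e] J j by simp
    qed (use inv j J orig_owner[OF j] owner_expr_val[OF e J j] size_expr_val[OF e J j] in
        \<open>auto simp: sizes_inv_def\<close>)
  next
    show "ok w (Sub vN vJ) m \<and> \<not> 0 < val (Sub vN vJ) m" if "sizes_inv n m" for m
      using env_header(2)[OF env[OF that]] that by (simp add: sizes_inv_def)
  qed (rule m)
qed auto

definition scale_inv :: "nat \<Rightarrow> mem \<Rightarrow> bool" where
  "scale_inv k m \<longleftrightarrow> (\<forall>a. - 10 < a \<and> a \<notin> {- 1, - 2, - 4} \<longrightarrow> m a = load xs a) \<and>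
     m (- 1) = posprod k \<and> m (- 2) = P \<and> m (- 4) = int k \<and> (\<forall>i<p. m (- 10 - int i) = orig_size I i)"

definition scaled :: "mem \<Rightarrow> bool" where
  "scaled m \<longleftrightarrow> (\<forall>a. - 10 < a \<and> a \<notin> {- 1, - 2, - 4} \<longrightarrow> m a = load xs a) \<and>
     m (- 1) = D \<and> m (- 2) = P \<and> (\<forall>i<p. m (- 10 - int i) = orig_size I i)"

lemma wp_scale:
  assumes "sizes_inv n m"
  shows "wp w (scale_com p) (1 + (1 + ((len * (1 + (1 + 1) + 1) + 1) + 1))) scaled m"
  unfolding scale_com_def
proof (rule wp_Seq, rule wp_Assign)
  show "wp w (Seq (Assign (Num (- 4)) (Num 0)) (Seq (While (Sub (Var 0) vJ)
         (Seq (Assign (Num (- 4)) (Add vJ (Num 1))) (If (Cell vJ) (Assign (Num (- 1)) (Mul vD (Cell vJ))) Skip)))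
       (Assign (Num (- 1)) (Mul vD (eprod (\<lambda>i. Var (- 10 - int i)) p)))))
     (1 + (len * (1 + (1 + 1) + 1) + 1 + 1)) scaled (m(val (Num (- 1)) m := val (Num 1) m))"
  proof (rule wp_Seq, rule wp_Assign, goal_cases)
    case 3
    have env: "env m" if "scale_inv j m" for j m
      using that by (auto simp: scale_inv_def env_def)
    show ?case
    proof (rule wp_Seq')
      show "wp w (While (Sub (Var 0) vJ)
         (Seq (Assign (Num (- 4)) (Add vJ (Num 1))) (If (Cell vJ) (Assign (Num (- 1)) (Mul vD (Cell vJ))) Skip)))
        (len * (1 + (1 + 1) + 1) + 1) (scale_inv len)
        ((m(val (Num (- 1)) m := val (Num 1) m))(val (Num (- 4)) (m(val (Num (- 1)) m := val (Num 1) m)) :=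
           val (Num 0) (m(val (Num (- 1)) m := val (Num 1) m))))"
      proof (rule wp_While[where Inv = scale_inv])
        fix k m assume k: "k < len" and inv: "scale_inv k m"
        note e = env[OF inv]
        have J: "m (- 4) = int k" using inv by (simp add: scale_inv_def)
        have c: "m (int k + 1) = xs ! k" using env_nth[OF e k] by (simp add: add.commute)
        have sh: "bit_length (m (int k + 1)) \<le> w" using env_short[OF e, of "int k + 1"] k by simp
        show "ok w (Sub (Var 0) vJ) m \<and> 0 < val (Sub (Var 0) vJ) m \<and>
          wp w (Seq (Assign (Num (- 4)) (Add vJ (Num 1))) (If (Cell vJ) (Assign (Num (- 1)) (Mul vD (Cell vJ))) Skip))
            (1 + (1 + 1)) (scale_inv (Suc k)) m"
        proof (intro conjI wp_Seq wp_If wp_Assign wp_Skip)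
          show "0 < val (Sub (Var 0) vJ) m" using env_header(1)[OF e] J k by simp
        qed (use inv c sh J in \<open>auto simp: scale_inv_def posprod_def\<close>)
      next
        show "ok w (Sub (Var 0) vJ) m \<and> \<not> 0 < val (Sub (Var 0) vJ) m" if "scale_inv len m" for m
          using env_header(1)[OF env[OF that]] that by (simp add: scale_inv_def)
      qed (use assms in \<open>auto simp: scale_inv_def posprod_def sizes_inv_def orig_size_sum P_def\<close>)
    next
      fix m assume inv: "scale_inv len m"
      show "wp w (Assign (Num (- 1)) (Mul vD (eprod (\<lambda>i. Var (- 10 - int i)) p))) 1 scaled m"
        using inv short_size by (intro wp_Assign)
          (auto simp: scale_inv_def scaled_def D_def intro!: ok_eprodI)
    qed
  qed auto
qed auto

text \<open>\<open>q\<close> is the state being left and \<open>t\<close> the number of the next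
  step. They are separate because \<open>t\<close> runs from \<open>q * p\<close> to
  \<open>q * p + p\<close> while \<open>q\<close> stays; the last value is the first one for
  \<open>q + 1\<close>.\<close>

definition rows_inv :: "nat \<Rightarrow> int \<Rightarrow> int \<Rightarrow> mem \<Rightarrow> bool" where
  "rows_inv j q t m \<longleftrightarrow> env m \<and> m (- 1) = D \<and> m (- 2) = P \<and> m (- 3) = int p ^ j \<and> m (- 4) = int j \<and>
     m (- 5) = q \<and> m (- 6) = 0 \<and> (\<forall>i<p. m (- 10 - int i) = orig_size I i) \<and>
     (\<forall>x\<ge>0. opt (S t x) (m (int len + 1 + x)))"

lemma wp_edge:
  assumes inv: "rows_inv j q (q * int p + int i) m" and "j < n" "i < p"
    and q: "int j * R \<le> q" "q < (int j + 1) * R"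
  shows "wp w (edge_com weighted p s M i) (1 + 3) (rows_inv j q (q * int p + int (Suc i))) m"
  unfolding edge_com_def
proof (rule wp_If)
  let ?t = "q * int p + int i"
  have e: "env m" and J: "m (- 4) = int j" and Q: "m (- 5) = q"
    using inv by (simp_all add: rows_inv_def)
  have q0: "0 \<le> q" using q(1) R_pos by (simp add: order_trans[of 0 "int j * R"])
  have tab: "val (table vQ) m = int len + 1 + q"
    using env_header(1)[OF e] Q by (simp add: table_def)
  have opt_q: "opt (S ?t q) (m (int len + 1 + q))" using inv q0 by (simp add: rows_inv_def)
  have t: "q * int p + int (Suc i) = ?t + 1" by simp
  show "ok w (Cell (table vQ)) m" by (simp add: table_def)
  show "wp w Skip 3 (rows_inv j q (q * int p + int (Suc i))) m" if "\<not> 0 < val (Cell (table vQ)) m"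
  proof -
    have "S ?t q = {}" using opt_zero[OF opt_q] that tab by simp
    then have "S (?t + 1) x = S ?t x" for x
      unfolding S_step[OF assms(2,3) q] by simp
    then have "rows_inv j q (q * int p + int (Suc i)) m" using inv unfolding rows_inv_def t by simp
    then show ?thesis by (intro wp_mono[OF wp_Skip]) auto
  qed
  show "wp w (relax (table (Add vQ (shift_expr p s M i))) (Add (Cell (table vQ)) (expense_expr weighted p s i)))
     3 (rows_inv j q (q * int p + int (Suc i))) m" if pos: "0 < val (Cell (table vQ)) m"
  proof (rule wp_relax)
    have pos': "0 < m (int len + 1 + q)" using pos tab by simp
    have exp: "val (expense_expr weighted p s i) m = expense j i" "ok w (expense_expr weighted p s i) m"
      using inv assms(3) by (auto intro!: expense_expr_val e J assms(2,3) simp: rows_inv_def)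
    note sh = shift_expr_val[OF e J assms(2,3)]
    show "ok w (table (Add vQ (shift_expr p s M i))) m" using sh by (simp add: table_def)
    show "ok w (Add (Cell (table vQ)) (expense_expr weighted p s i)) m" using exp by (simp add: table_def)
    \<comment> \<open>An assignment that reaches \<open>q\<close> is needed as a witness: extended
      by \<open>i\<close>, it shows that the target state is nonnegative, so the write goes into the
      table and leaves the input intact.\<close>
    have "S ?t q \<noteq> {}" using opt_q pos' by (auto simp: opt_def)
    then obtain a j' where a: "valid j' a" "st a j' = q" unfolding S_def by blast
    have "j' = j" using row_unique[OF _ _ q] st_rows[OF a(1)] a(2) by blast
    then have "valid (Suc j) (a(j := i))" "st (a(j := i)) (Suc j) = q + shift j i"
      using a assms(2,3) valid_upd st_upd by auto
    then have "int (Suc j) * R \<le> q + shift j i" using st_rows by metis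
    then have tgt: "0 \<le> q + shift j i" using R_pos by (simp add: order_trans[of 0 "int (Suc j) * R"])
    have tabt: "val (table (Add vQ (shift_expr p s M i))) m = int len + 1 + (q + shift j i)"
      using env_header(1)[OF e] Q sh(1) by (simp add: table_def)
    have "opt (S (?t + 1) x) (if x = q + shift j i
        then omin (m (int len + 1 + x)) (m (int len + 1 + q) + expense j i)
        else m (int len + 1 + x))" if "0 \<le> x" for x
    proof -
      have "opt (S ?t x) (m (int len + 1 + x))" using inv that by (simp add: rows_inv_def)
      moreover have "0 \<le> expense j i"
        unfolding expense_def using icost_nonneg[OF assms(2,3)] P_pos by simp
      ultimately show ?thesis
        unfolding S_step[OF assms(2,3) q] using opt_shift[OF opt_q pos', of "expense j i"] pos'
        by (auto intro: opt_union)
    qed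
    note step = this
    have "opt (S (?t + 1) (q + shift j i)) (omin (m (int len + 1 + (q + shift j i)))
        (m (int len + 1 + q) + expense j i))"
      using step[OF tgt] by simp
    moreover have "opt (S (?t + 1) x) (m (int len + 1 + x))" if "0 \<le> x" "x \<noteq> q + shift j i" for x
      using step[of x] that by simp
    ultimately show "rows_inv j q (q * int p + int (Suc i))
      (m(val (table (Add vQ (shift_expr p s M i))) m :=
        omin (m (val (table (Add vQ (shift_expr p s M i))) m)) (val (Add (Cell (table vQ)) (expense_expr weighted p s i)) m)))"
      using inv tgt exp(1) unfolding t tabt rows_inv_def val.simps tab
      by (auto intro!: env_upd)
  qed
qed

lemma wp_row:
  assumes inv: "rows_inv j (int j * R) (int j * R * int p) m" and j: "j < n"
  shows "wp w (row_com weighted p s M) (nat R * (p * (1 + 3) + 1 + 1 + 1) + 1)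
     (rows_inv j (int (Suc j) * R) (int (Suc j) * R * int p)) m"
proof -
  define inv' where "inv' k = rows_inv j (int j * R + int k) ((int j * R + int k) * int p)" for k :: nat
  have R: "int (nat R) = R" using R_pos by simp
  have "wp w (row_com weighted p s M) (nat R * ((p * (1 + 3) + 1 + 1) + 1) + 1) (inv' (nat R)) m"
    unfolding row_com_def
  proof (rule wp_While)
    show "inv' 0 m" using inv by (simp add: inv'_def)
    have guard: "ok w (Sub (Mul (Add vJ (Num 1)) (power_expr M K)) vQ) m \<and>
      val (Sub (Mul (Add vJ (Num 1)) (power_expr M K)) vQ) m = R - int k" if "inv' k m" for k m
    proof -
      have *: "env m" "m (- 4) = int j" "m (- 5) = int j * R + int k"
        using that unfolding inv'_def rows_inv_def by auto
      show ?thesis using base_expr_val[OF *(1)] *(2,3) by (simp add: R_def algebra_simps)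
    qed
    show "ok w (Sub (Mul (Add vJ (Num 1)) (power_expr M K)) vQ) m \<and>
      \<not> 0 < val (Sub (Mul (Add vJ (Num 1)) (power_expr M K)) vQ) m" if "inv' (nat R) m" for m
      using guard[OF that] R by simp
    fix k m assume k: "k < nat R" and inv: "inv' k m"
    let ?q = "int j * R + int k"
    have q: "int j * R \<le> ?q" "?q < (int j + 1) * R" using k R by (simp_all add: algebra_simps)
    have "wp w (Seq (seqs (edge_com weighted p s M) p) (Assign (Num (- 5)) (Add vQ (Num 1))))
       (p * (1 + 3) + 1 + 1) (inv' (Suc k)) m"
    proof (rule wp_Seq')
      show "wp w (seqs (edge_com weighted p s M) p) (p * (1 + 3) + 1) (rows_inv j ?q (?q * int p + int p)) m"
        using wp_edge[OF _ j _ q] inv unfolding inv'_def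
        by (intro wp_seqs[where Inv = "\<lambda>i. rows_inv j ?q (?q * int p + int i)"]) auto
      show "wp w (Assign (Num (- 5)) (Add vQ (Num 1))) 1 (inv' (Suc k)) m"
        if "rows_inv j ?q (?q * int p + int p) m" for m
        using that by (intro wp_Assign) (auto simp: inv'_def rows_inv_def algebra_simps intro!: env_upd)
    qed
    then show "ok w (Sub (Mul (Add vJ (Num 1)) (power_expr M K)) vQ) m \<and>
      0 < val (Sub (Mul (Add vJ (Num 1)) (power_expr M K)) vQ) m \<and>
      wp w (Seq (seqs (edge_com weighted p s M) p) (Assign (Num (- 5)) (Add vQ (Num 1))))
       (p * (1 + 3) + 1 + 1) (inv' (Suc k)) m"
      using guard[OF inv] k by simp
  qed
  moreover have "inv' (nat R) = rows_inv j (int (Suc j) * R) (int (Suc j) * R * int p)"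
    unfolding inv'_def R by (simp add: algebra_simps)
  ultimately show ?thesis by simp
qed

abbreviation "row_steps \<equiv> nat R * (p * (1 + 3) + 1 + 1 + 1) + 1"

lemma wp_rows:
  assumes "scaled m"
  shows "wp w (rows_com weighted p s M) (1 + (1 + (1 + (n * (row_steps + (1 + 1) + 1) + 1))))
    (rows_inv n (int n * R) (int n * R * int p)) m"
proof -
  define inv' where "inv' j = rows_inv j (int j * R) (int j * R * int p)" for j :: nat
  define m1 where "m1 = m(- 3 := 1, - 4 := 0)"
  have m: "env m1" "m1 (- 2) = P"
    using assms unfolding m1_def scaled_def env_def by auto
  have "start + (\<Sum>l<0. shift l 0) \<ge> 0"
    using state_rows[of 0 "\<lambda>_. 0"] by simp
  then have start: "0 \<le> start" by simp
  have init: "inv' 0 (m1(int len + 1 + start := P))"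
    using assms start unfolding inv'_def rows_inv_def m1_def scaled_def
    by (auto simp: S_init opt_def P_pos load_def env_def)
  have loop: "wp w (While (Sub vN vJ) (Seq (row_com weighted p s M)
         (Seq (Assign (Num (- 4)) (Add vJ (Num 1))) (Assign (Num (- 3)) (Mul vE (Num (int p)))))))
       (n * (row_steps + (1 + 1) + 1) + 1) (inv' n) (m1(int len + 1 + start := P))"
  proof (rule wp_While[where Inv = inv', OF init])
    fix j m assume j: "j < n" and inv: "inv' j m"
    have "wp w (Seq (row_com weighted p s M)
         (Seq (Assign (Num (- 4)) (Add vJ (Num 1))) (Assign (Num (- 3)) (Mul vE (Num (int p))))))
       (row_steps + (1 + 1)) (inv' (Suc j)) m"
    proof (rule wp_Seq'[OF wp_row[OF inv[unfolded inv'_def] j]])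
      show "wp w (Seq (Assign (Num (- 4)) (Add vJ (Num 1))) (Assign (Num (- 3)) (Mul vE (Num (int p)))))
        (1 + 1) (inv' (Suc j)) m" if "rows_inv j (int (Suc j) * R) (int (Suc j) * R * int p) m" for m
        using that by (intro wp_Seq wp_Assign) (auto simp: inv'_def rows_inv_def intro!: env_upd)
    qed
    then show "ok w (Sub vN vJ) m \<and> 0 < val (Sub vN vJ) m \<and>
      wp w (Seq (row_com weighted p s M)
         (Seq (Assign (Num (- 4)) (Add vJ (Num 1))) (Assign (Num (- 3)) (Mul vE (Num (int p))))))
       (row_steps + (1 + 1)) (inv' (Suc j)) m"
      using inv j env_header(2)[of m] by (auto simp: inv'_def rows_inv_def)
  next
    show "ok w (Sub vN vJ) m \<and> \<not> 0 < val (Sub vN vJ) m" if "inv' n m" for m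
      using that env_header(2)[of m] by (auto simp: inv'_def rows_inv_def)
  qed
  have "val (table (start_expr p s M)) m1 = int len + 1 + start" "ok w (table (start_expr p s M)) m1"
    using start_expr_val[OF m(1)] env_header(1)[OF m(1)] by (simp_all add: table_def)
  then show ?thesis
    using loop m(2) unfolding rows_com_def inv'_def m1_def
    by - (rule wp_Seq, rule wp_Assign, simp, simp, rule wp_Seq, rule wp_Assign, simp, simp,
      rule wp_Seq, rule wp_Assign, simp, simp, simp)
qed

definition select_inv :: "nat \<Rightarrow> mem \<Rightarrow> bool" where
  "select_inv k m \<longleftrightarrow> env m \<and> m (- 5) = int n * R + int k \<and>
     (\<forall>x\<ge>0. opt (S (int n * R * int p) x) (m (int len + 1 + x))) \<and>
     opt {vl a n |a. valid n a \<and> st a n < int n * R + int k \<and> feas_state (st a n)} (m (- 6))"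

text \<open>Complete assignments end in row \<open>n\<close>, at whose beginning \<open>vQ\<close>
  already stands, and the table is final there. Each round adds one state to the candidates.\<close>

lemma wp_select:
  assumes "rows_inv n (int n * R) (int n * R * int p) m"
  shows "wp w (select_com p s M) (nat R * (K + (K + (1 + 3)) + 1 + 1) + 1) (select_inv (nat R)) m"
  unfolding select_com_def
proof (rule wp_While)
  have "{vl a n |a. valid n a \<and> st a n < int n * R + int 0 \<and> feas_state (st a n)} = {}"
    using st_rows by force
  then show "select_inv 0 m" using assms by (simp add: select_inv_def rows_inv_def opt_def)
  have guard: "ok w (Sub (Mul (Add vN (Num 1)) (power_expr M K)) vQ) m \<and>
      val (Sub (Mul (Add vN (Num 1)) (power_expr M K)) vQ) m = R - int k" if "select_inv k m" for k m
  proof -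
    have *: "env m" "m (- 5) = int n * R + int k" using that unfolding select_inv_def by auto
    show ?thesis using base_expr_val[OF *(1)] *(2) env_header[OF *(1)] by (simp add: R_def algebra_simps)
  qed
  show "ok w (Sub (Mul (Add vN (Num 1)) (power_expr M K)) vQ) m \<and>
      \<not> 0 < val (Sub (Mul (Add vN (Num 1)) (power_expr M K)) vQ) m" if "select_inv (nat R) m" for m
    using guard[OF that] R_pos by simp
  fix k m assume k: "k < nat R" and inv: "select_inv k m"
  let ?q = "int n * R + int k"
  let ?F = "\<lambda>q. {vl a n |a. valid n a \<and> st a n < q \<and> feas_state (st a n)}"
  let ?T = "\<lambda>q. {vl a n |a. valid n a \<and> st a n = q}"
  let ?Q = "\<lambda>m. env m \<and> m (- 5) = ?q \<and>
     (\<forall>x\<ge>0. opt (S (int n * R * int p) x) (m (int len + 1 + x))) \<and> opt (?F (?q + 1)) (m (- 6))"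
  have e: "env m" and Q: "m (- 5) = ?q" using inv by (auto simp: select_inv_def)
  have q: "int n * R \<le> ?q" "?q < (int n + 1) * R" using k R_pos by (simp_all add: algebra_simps)
  have q0: "0 \<le> ?q" using R_pos by simp
  have tab: "val (table vQ) m = int len + 1 + ?q" using env_header(1)[OF e] Q by (simp add: table_def)
  have okt: "ok w (Cell (table vQ)) m" by (simp add: table_def)
  have opt_q: "opt (?T ?q) (m (int len + 1 + ?q))"
    using inv q0 S_final[OF q] unfolding select_inv_def by metis
  have F_step: "?F (?q + 1) = ?F ?q \<union> (if feas_state ?q then ?T ?q else {})"
    by (auto simp: less_le) 
  have opt_F: "opt (?F ?q) (m (- 6))" using inv by (simp add: select_inv_def)
  note feas = feas_exprs[OF e Q]
  have stay: "?Q m" if "?F (?q + 1) = ?F ?q"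
    unfolding that using inv by (simp add: select_inv_def)
  have inner: "wp w (If (Cell (table vQ)) (relax (Num (- 6)) (Cell (table vQ))) Skip) (1 + 3) ?Q m"
    if "feas_state ?q"
  proof (rule wp_If[OF okt])
    assume "0 < val (Cell (table vQ)) m"
    then have pos: "0 < m (int len + 1 + ?q)" using tab by simp
    have "opt (?F (?q + 1)) (omin (m (- 6)) (m (int len + 1 + ?q)))"
      unfolding F_step using that opt_union[OF opt_F opt_q pos] by simp
    then show "wp w (relax (Num (- 6)) (Cell (table vQ))) 3 ?Q m"
      using okt inv tab by (intro wp_relax) (auto simp: select_inv_def intro!: env_upd)
  next
    assume "\<not> 0 < val (Cell (table vQ)) m"
    then have "?T ?q = {}" using opt_zero[OF opt_q] tab by simp
    then have "?F (?q + 1) = ?F ?q" unfolding F_step by (simp only: if_cancel Un_empty_right)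
    then show "wp w Skip 3 ?Q m" by (intro wp_mono[OF wp_Skip[of ?Q m]] stay) auto
  qed
  have "wp w (ifs (lower_expr s M) K (ifs (upper_expr s M) K
         (If (Cell (table vQ)) (relax (Num (- 6)) (Cell (table vQ))) Skip))) (K + (K + (1 + 3))) ?Q m"
  proof (intro wp_ifs inner)
    have "?Q m" if "\<not> feas_state ?q" using that F_step by (intro stay) simp
    then show "\<not> (\<forall>x<K. 0 < val (lower_expr s M x) m) \<Longrightarrow> ?Q m"
      "\<not> (\<forall>x<K. 0 < val (upper_expr s M x) m) \<Longrightarrow> ?Q m" using feas(1) by blast+
  qed (use feas in auto)
  then have "wp w (Seq (ifs (lower_expr s M) K (ifs (upper_expr s M) K
         (If (Cell (table vQ)) (relax (Num (- 6)) (Cell (table vQ))) Skip)))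
       (Assign (Num (- 5)) (Add vQ (Num 1)))) (K + (K + (1 + 3)) + 1) (select_inv (Suc k)) m"
  proof (rule wp_Seq')
    show "wp w (Assign (Num (- 5)) (Add vQ (Num 1))) 1 (select_inv (Suc k)) m" if "?Q m" for m
      using that by (intro wp_Assign) (auto simp: select_inv_def algebra_simps intro!: env_upd)
  qed
  then show "ok w (Sub (Mul (Add vN (Num 1)) (power_expr M K)) vQ) m \<and>
      0 < val (Sub (Mul (Add vN (Num 1)) (power_expr M K)) vQ) m \<and>
      wp w (Seq (ifs (lower_expr s M) K (ifs (upper_expr s M) K
         (If (Cell (table vQ)) (relax (Num (- 6)) (Cell (table vQ))) Skip)))
       (Assign (Num (- 5)) (Add vQ (Num 1)))) (K + (K + (1 + 3)) + 1) (select_inv (Suc k)) m"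
    using guard[OF inv] k by simp
qed

definition solved :: "mem \<Rightarrow> bool" where
  "solved m \<longleftrightarrow> (\<exists>\<pi>. read_out m = encode_partition I \<pi> \<and> is_arg_min obj (feasible I) \<pi>)"

lemma select_optimal:
  assumes "select_inv (nat R) m"
  shows "\<exists>a. valid n a \<and> m (- 6) = vl a n \<and> is_arg_min obj (feasible I) (part I a)"
proof -
  let ?F = "{vl a n |a. valid n a \<and> feas_state (st a n)}"
  have "st a n < int n * R + int (nat R)" if "valid n a" for a
    using st_rows[OF that] R_pos by (simp add: algebra_simps)
  then have "{vl a n |a. valid n a \<and> st a n < int n * R + int (nat R) \<and> feas_state (st a n)} = ?F" by blast
  then have opt: "opt ?F (m (- 6))" using assms by (simp add: select_inv_def)
  have "valid n (owner I (original I))" using orig_owner by (simp add: valid_def)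
  \<comment> \<open>Feasibility of the original distribution enters here: the best value is attained
    and is not the mark 0.\<close>
  then have "?F \<noteq> {}" using orig(2) feasible_iff by blast
  with opt have mem: "m (- 6) \<in> ?F" and min: "\<forall>v\<in>?F. m (- 6) \<le> v" unfolding opt_def by blast+
  from mem obtain a where a: "valid n a" "feas_state (st a n)" "m (- 6) = vl a n" by blast
  have "vl a n \<le> vl b n" if "valid n b" "feas_state (st b n)" for b
    using min that unfolding a(3) by blast
  then have "is_arg_min obj (feasible I) (part I a)" using a by (intro minimal_value)
  with a show ?thesis by blast
qed

lemma wp_decode:
  assumes "select_inv (nat R) m"
  shows "wp w (decode_com p) (1 + (1 + ((n * (1 + (1 + 1) + 1) + 1) + 1))) solved m"
proof -
  obtain a where a: "valid n a" "m (- 6) = vl a n" "is_arg_min obj (feasible I) (part I a)"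
    using select_optimal[OF assms] by blast
  define inv' where "inv' k m \<longleftrightarrow> m (- 1) = int n \<and> m (- 4) = int k \<and> m (- 6) = vl a n div int p ^ k \<and>
    (\<forall>j<k. m (int j + 1) = int (a j))" for k :: nat and m :: mem
  have e: "env m" using assms by (simp add: select_inv_def)
  have "wp w (While (Sub vD vJ) (Seq (Assign (Num (- 4)) (Add vJ (Num 1)))
           (Seq (Assign vJ (Sub vBest (Mul (Num (int p)) (Div vBest (Num (int p))))))
             (Assign (Num (- 6)) (Div vBest (Num (int p)))))))
     (n * (1 + (1 + 1) + 1) + 1) (inv' n) (m(- 1 := int n, - 4 := 0))"
  proof (rule wp_While)
    show "inv' 0 (m(- 1 := int n, - 4 := 0))" using a by (simp add: inv'_def)
    show "ok w (Sub vD vJ) m \<and> \<not> 0 < val (Sub vD vJ) m" if "inv' n m" for m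
      using that by (simp add: inv'_def)
    fix k m assume k: "k < n" and inv: "inv' k m"
    have "vl a n div int p ^ k - int p * (vl a n div int p ^ k div int p) = int (a k)"
      using vl_digit[OF a(1) k] by (simp add: minus_mult_div_eq_mod)
    moreover have "vl a n div int p ^ k div int p = vl a n div int p ^ Suc k"
      by (simp add: zdiv_zmult2_eq power_Suc2 del: power_Suc)
    ultimately show "ok w (Sub vD vJ) m \<and> 0 < val (Sub vD vJ) m \<and>
      wp w (Seq (Assign (Num (- 4)) (Add vJ (Num 1)))
           (Seq (Assign vJ (Sub vBest (Mul (Num (int p)) (Div vBest (Num (int p))))))
             (Assign (Num (- 6)) (Div vBest (Num (int p))))))
       (1 + (1 + 1)) (inv' (Suc k)) m"
      using inv k by (intro conjI wp_Seq wp_Assign) (auto simp: inv'_def less_Suc_eq simp del: power_Suc)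
  qed
  then have loop: "wp w (Seq (While (Sub vD vJ) (Seq (Assign (Num (- 4)) (Add vJ (Num 1)))
           (Seq (Assign vJ (Sub vBest (Mul (Num (int p)) (Div vBest (Num (int p))))))
             (Assign (Num (- 6)) (Div vBest (Num (int p)))))))
       (Assign (Num 0) vD)) ((n * (1 + (1 + 1) + 1) + 1) + 1) solved (m(- 1 := int n, - 4 := 0))"
  proof (rule wp_Seq')
    fix m assume inv: "inv' n m"
    have "read_out (m(0 := int n)) = map (\<lambda>j. int (a j)) [0..<n]"
      using inv by (simp add: read_out_def inv'_def)
    also have "\<dots> = encode_partition I (part I a)"
      using owner_part[of I a] a(1) farmers by (simp add: encode_partition_def valid_def)
    finally have "solved (m(0 := int n))" using a(3) by (auto simp: solved_def)
    then show "wp w (Assign (Num 0) vD) 1 solved m"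
      using inv by (intro wp_Assign) (simp_all add: inv'_def)
  qed
  then show ?thesis
    unfolding decode_com_def using env_header(2)[OF e]
    by - (rule wp_Seq, rule wp_Assign, simp, simp, rule wp_Seq, rule wp_Assign, simp, simp, simp)
qed

lemma wp_solve:
  "wp w (solve_com weighted p s M)
    ((1 + (n * (1 + (1 + 1) + 1) + 1)) + ((1 + (1 + ((len * (1 + (1 + 1) + 1) + 1) + 1))) +
     ((1 + (1 + (1 + (n * (row_steps + (1 + 1) + 1) + 1)))) +
      ((nat R * (K + (K + (1 + 3)) + 1 + 1) + 1) + (1 + (1 + ((n * (1 + (1 + 1) + 1) + 1) + 1)))))))
    solved (load xs)"
  unfolding solve_com_def
  by (intro wp_Seq'[OF wp_sizes] wp_Seq'[OF wp_scale] wp_Seq'[OF wp_rows] wp_Seq'[OF wp_select] wp_decode)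

end

section \<open>Polynomial running time\<close>

definition poly_fun :: "(nat \<Rightarrow> nat) \<Rightarrow> bool" where
  "poly_fun f \<longleftrightarrow> (\<exists>P. \<forall>x. f x = poly P x)"

lemma poly_fun_const: "poly_fun (\<lambda>x. c)"
  unfolding poly_fun_def by (intro exI[of _ "[:c:]"]) simp

lemma poly_fun_ident: "poly_fun (\<lambda>x. x)"
  unfolding poly_fun_def by (intro exI[of _ "[:0, 1:]"]) simp

lemma poly_fun_add: "poly_fun f \<Longrightarrow> poly_fun g \<Longrightarrow> poly_fun (\<lambda>x. f x + g x)"
  unfolding poly_fun_def by (metis poly_add)

lemma poly_fun_mult: "poly_fun f \<Longrightarrow> poly_fun g \<Longrightarrow> poly_fun (\<lambda>x. f x * g x)"
  unfolding poly_fun_def by (metis poly_mult)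

lemma poly_fun_power: "poly_fun f \<Longrightarrow> poly_fun (\<lambda>x. f x ^ k)"
  unfolding poly_fun_def by (metis poly_power)

lemmas poly_fun_intros =
  poly_fun_const poly_fun_ident poly_fun_add poly_fun_mult poly_fun_power

text \<open>\<open>D\<close> accounts for \<open>4 + x + p * (1 + x * M)\<close>: the product of the
  entries and \<open>p\<close> original sizes. One further \<open>1 + x * M\<close> leaves room for
  a single original size.\<close>

definition word_bound :: "nat \<Rightarrow> nat \<Rightarrow> nat \<Rightarrow> nat" where
  "word_bound p M x = 4 + x + (p + 1) * (1 + x * M)"

text \<open>Bounds the number \<open>R\<close> of states in a row. It is polynomial in
  \<open>x\<close> because the exponent is constant, which is where fixing \<open>p\<close> and
  \<open>s\<close> is essential.\<close>

definition row_bound :: "nat \<Rightarrow> nat \<Rightarrow> nat \<Rightarrow> nat \<Rightarrow> nat" where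
  "row_bound p s M x = (2 * M * x + 1) ^ (p * s)"

definition step_bound :: "nat \<Rightarrow> nat \<Rightarrow> nat \<Rightarrow> nat \<Rightarrow> nat" where
  "step_bound p s M x =
    (1 + (x * (1 + (1 + 1) + 1) + 1)) + ((1 + (1 + ((x * (1 + (1 + 1) + 1) + 1) + 1))) +
     ((1 + (1 + (1 + (x * ((row_bound p s M x * (p * (1 + 3) + 1 + 1 + 1) + 1) + (1 + 1) + 1) + 1)))) +
      ((row_bound p s M x * (p * s + (p * s + (1 + 3)) + 1 + 1) + 1) +
       (1 + (1 + ((x * (1 + (1 + 1) + 1) + 1) + 1))))))"

text \<open>The bound from \<open>exec_if_steps\<close>, with \<open>x + 1\<close> for the length of
  the initial cells.\<close>

definition time_bound :: "nat \<Rightarrow> nat \<Rightarrow> nat \<Rightarrow> nat \<Rightarrow> nat \<Rightarrow> nat" where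
  "time_bound c p s M x = step_bound p s M x * c *
     (x + 1 + step_bound p s M x * c * word_bound p M x)\<^sup>2"

lemma poly_fun_time_bound: "poly_fun (time_bound c p s M)"
  unfolding time_bound_def step_bound_def row_bound_def word_bound_def
  by (intro poly_fun_intros)

lemma bit_length_1: "bit_length 1 \<le> 2"
  using bit_length_le_Suc_iff[of 1 1] by (simp add: numeral_2_eq_2)

lemma bit_length_prod: "bit_length (\<Prod>a<k. f a) \<le> 2 + (\<Sum>a<k. bit_length (f a))" for k :: nat
proof (induction k)
  case 0
  show ?case using bit_length_1 by simp
next
  case (Suc k)
  then show ?case using bit_length_mult[of "\<Prod>a<k. f a" "f k"] by simp
qed

lemma binary_length_nth: "binary_length xs = (\<Sum>a<length xs. bit_length (xs ! a))"
  by (simp add: binary_length_def sum_list_sum_nth atLeast0LessThan)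

lemma length_le_binary_length: "length xs \<le> binary_length xs"
proof -
  have "(\<Sum>a<length xs. 1) \<le> (\<Sum>a<length xs. bit_length (xs ! a))"
    by (intro sum_mono) (simp add: Suc_le_eq)
  then show ?thesis by (simp add: binary_length_nth)
qed

lemma load_bit_length: "bit_length (load xs a) \<le> binary_length xs + 1"
proof -
  have "bit_length (int (length xs)) \<le> binary_length xs + 1"
    using bit_length_nonneg_le[of "int (length xs)"] length_le_binary_length[of xs] by simp
  moreover have "bit_length (xs ! k) \<le> binary_length xs" if "k < length xs" for k
    unfolding binary_length_nth using that by (intro member_le_sum) auto
  moreover have "bit_length 0 \<le> 1" by (simp add: bit_length_def floorlog_def)
  ultimately show ?thesis by (auto simp: load_def intro: le_SucI)
qed

context land_problem begin

abbreviation "size_bound \<equiv> binary_length xs"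

lemma n_le: "n \<le> size_bound"
  by (rule num_lots_le_binary_length)

lemma orig_size_le: "i < p \<Longrightarrow> orig_size I i \<le> int (n * M)"
proof -
  assume i: "i < p"
  have sub: "original I i \<subseteq> {..<n}" using orig(1) i farmers by (auto simp: is_partition_def)
  have "lot_size I j \<le> int M" if "j \<in> original I i" for j
    using weight_le[of j "size_feature I" 0] sf p_pos sub that unfolding lot_size_def by force
  then have "orig_size I i \<le> of_nat (card (original I i)) * int M"
    unfolding orig_size_def by (rule sum_bounded_above)
  also have "\<dots> \<le> int n * int M"
    using card_mono[OF _ sub] by (intro mult_right_mono) auto
  finally show ?thesis by simp
qed

text \<open>The value itself serves as a bound on the length; this crude estimate is linear because
  \<open>M\<close> is constant.\<close>

lemma orig_size_bit_length: "i < p \<Longrightarrow> bit_length (orig_size I i) \<le> 1 + size_bound * M"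
proof -
  assume i: "i < p"
  have "bit_length (orig_size I i) \<le> nat (orig_size I i) + 1"
    using orig_size_pos[OF i] by (intro bit_length_nonneg_le) simp
  also have "nat (orig_size I i) \<le> n * M" using orig_size_le[OF i] by (simp only: nat_le_iff)
  also have "n * M + 1 \<le> size_bound * M + 1" using n_le by simp
  finally show ?thesis by simp
qed

lemma D_bit_length: "bit_length D \<le> 4 + size_bound + p * (1 + size_bound * M)"
proof -
  have "bit_length (posprod (length xs)) \<le> 2 + size_bound"
  proof -
    have "bit_length (posprod k) \<le> 2 + (\<Sum>a<k. bit_length (xs ! a))" for k
    proof (induction k)
      case 0
      show ?case using bit_length_1 by (simp add: posprod_def)
    next
      case (Suc k)
      have "posprod (Suc k) = posprod k \<or> posprod (Suc k) = posprod k * xs ! k"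
        by (simp add: posprod_def)
      then show ?case using Suc bit_length_mult[of "posprod k" "xs ! k"] by auto
    qed
    then show ?thesis by (simp add: binary_length_nth)
  qed
  moreover have "(\<Sum>i<p. bit_length (orig_size I i)) \<le> (\<Sum>i<p. 1 + size_bound * M)"
    by (intro sum_mono orig_size_bit_length) simp
  then have "bit_length (\<Prod>i<p. orig_size I i) \<le> 2 + p * (1 + size_bound * M)"
    using bit_length_prod[of "orig_size I" p] by simp
  ultimately show ?thesis
    unfolding D_def using bit_length_mult[of "posprod (length xs)" "\<Prod>i<p. orig_size I i"] by linarith
qed

lemma R_le: "nat R \<le> row_bound p s M size_bound"
proof -
  have "R = int ((2 * M * n + 1) ^ K)" by (simp add: R_def B_def add.commute)
  then have "nat R = (2 * M * n + 1) ^ K" by (simp only: nat_int)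
  also have "\<dots> \<le> (2 * M * size_bound + 1) ^ K" using n_le by (intro power_mono) auto
  finally show ?thesis by (simp add: row_bound_def)
qed

lemma exec_solve:
  "\<exists>t m. exec (solve_com weighted p s M) (load xs) t m \<and>
     t \<le> time_bound (ccost (solve_com weighted p s M)) p s M size_bound \<and>
     (\<exists>\<pi>. read_out m = encode_partition I \<pi> \<and> is_arg_min obj (feasible I) \<pi>)"
proof -
  let ?w = "word_bound p M size_bound"
  let ?c = "ccost (solve_com weighted p s M)"
  have sw: "4 + size_bound + p * (1 + size_bound * M) \<le> ?w" "1 + size_bound * M \<le> ?w" "size_bound + 1 \<le> ?w"
    by (simp_all add: word_bound_def)
  interpret land_program p s M I weighted ?w
  proof unfold_locales
    show "bit_length (load xs (int k)) \<le> ?w" for k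
      using load_bit_length[of xs "int k"] sw(3) by linarith
    show "bit_length D \<le> ?w" using D_bit_length sw(1) by linarith
    show "bit_length (orig_size I i) \<le> ?w" if "i < p" for i
      using orig_size_bit_length[OF that] sw(2) by linarith
  qed
  have "wp ?w (solve_com weighted p s M) (step_bound p s M size_bound) solved (load xs)"
    by (rule wp_mono[OF wp_solve])
      (unfold step_bound_def, intro add_mono mult_le_mono order_refl n_le R_le length_le_binary_length)
  then obtain k m where k: "steps ?w (solve_com weighted p s M) (load xs) k m"
    "k \<le> step_bound p s M size_bound" "solved m"
    unfolding wp_def by blast
  have "1 \<le> ?w" using sw(3) by linarith
  from exec_if_steps[OF k(1) this load_bit_length order_refl order_refl] obtain t where
    t: "exec (solve_com weighted p s M) (load xs) t m"
      "t \<le> k * ?c * (size_bound + 1 + k * ?c * ?w)\<^sup>2" by blast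
  have "k * ?c * (size_bound + 1 + k * ?c * ?w)\<^sup>2 \<le> time_bound ?c p s M size_bound"
    unfolding time_bound_def using k(2) by (intro mult_le_mono power_mono add_mono) auto
  with t k(3) show ?thesis unfolding solved_def by (meson order_trans)
qed

end

lemma poly_time_objective:
  assumes "finite \<Omega>"
  shows "poly_time_computable (instances p s \<Omega>) encode
     (\<lambda>I out. \<exists>\<pi>. out = encode_partition I \<pi> \<and>
        is_arg_min (objective weighted I) (feasible I) \<pi>)"
proof -
  define E where "E = (\<Union>A\<in>\<Omega>. (\<lambda>(k, i). nat \<bar>A $$ (k, i)\<bar>) ` ({..<s} \<times> {..<p}))"
  \<comment> \<open>Inserting 0 keeps the maximum defined if \<open>E\<close> is empty, and
    \<open>Suc\<close> ensures that \<open>M\<close> is at least 1.\<close>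
  define M where "M = Suc (Max (insert 0 E))"
  have "finite E" unfolding E_def using assms by auto
  then have M: "\<bar>A $$ (k, i)\<bar> \<le> int M" if "A \<in> \<Omega>" "k < s" "i < p" for A k i
  proof -
    have "nat \<bar>A $$ (k, i)\<bar> \<in> E" unfolding E_def using that by force
    then have "nat \<bar>A $$ (k, i)\<bar> \<le> Max (insert 0 E)" using \<open>finite E\<close> by (intro Max_ge) auto
    then show ?thesis unfolding M_def by linarith
  qed
  obtain Q where Q: "\<And>x. time_bound (ccost (solve_com weighted p s M)) p s M x = poly Q x"
    using poly_fun_time_bound unfolding poly_fun_def by blast
  show ?thesis
    unfolding poly_time_computable_def
  proof (rule exI, rule exI, rule ballI)
    fix I assume I: "I \<in> instances p s \<Omega>"
    interpret land_problem p s M I weighted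
      using I M by unfold_locales (auto simp: instances_def M_def)
    show "\<exists>t m. exec (solve_com weighted p s M) (load (encode I)) t m \<and>
        t \<le> poly Q (binary_length (encode I)) \<and>
        (\<exists>\<pi>. read_out m = encode_partition I \<pi> \<and> is_arg_min obj (feasible I) \<pi>)"
      using exec_solve unfolding Q .
  qed
qed

section \<open>Approximation of \<open>f2\<close>\<close>

text \<open>With \<open>?a\<close> and \<open>?b\<close> the two maxima, the chain is \<open>f2 I
  \<pi> \<le> ?a * f3 I \<pi> \<le> ?a * f3 I \<pi>' \<le> ?a * ?b * f2 I \<pi>'\<close>. The outer
  estimates compare summands, using the lower size bound for \<open>\<pi>\<close> and the upper one
  for \<open>\<pi>'\<close>.\<close>

lemma f2_f3_ratio:
  assumes I: "land_instance I" and \<pi>: "is_arg_min (f3 I) (feasible I) \<pi>" and \<pi>': "feasible I \<pi>'"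
  shows "f2 I \<pi> \<le> approx_factor I * f2 I \<pi>'"
proof -
  let ?p = "num_farmers I"
  let ?c = "\<lambda>\<pi> i. \<Sum>j\<in>\<pi> i. of_int (lot_size I j) * sq_dist I i j"
  let ?a = "MAX i\<in>{..<?p}. real_of_int (orig_size I i) / of_rat (lower_size I i)"
  let ?b = "MAX i\<in>{..<?p}. real_of_rat (upper_size I i) / of_int (orig_size I i)"
  have feas: "feasible I \<pi>" and opt: "f3 I \<pi> \<le> f3 I \<pi>'"
    using \<pi> \<pi>' by (auto simp: is_arg_min_def not_less)
  have pos: "0 < lower_size I i" "0 < orig_size I i" if "i < ?p" for i
    using I that by (auto simp: land_instance_def)
  have size: "real_of_rat (lower_size I i) \<le> of_int (\<Sum>j\<in>\<pi> i. lot_size I j) \<and>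
      of_int (\<Sum>j\<in>\<pi> i. lot_size I j) \<le> real_of_rat (upper_size I i)"
    and c_nonneg: "0 \<le> ?c \<pi> i" if "feasible I \<pi>" "i < ?p" for \<pi> i
  proof -
    have sub: "j < num_lots I" if "j \<in> \<pi> i" for j
      using \<open>feasible I \<pi>\<close> \<open>i < ?p\<close> that by (auto simp: feasible_def is_partition_def)
    have "(\<Sum>j\<in>\<pi> i. weight I j $$ (size_feature I, i)) = (\<Sum>j\<in>\<pi> i. lot_size I j)"
      using I sub that(2) by (intro sum.cong) (auto simp: land_instance_def)
    moreover have "size_feature I < num_features I" using I by (simp add: land_instance_def)
    ultimately have "lower_size I i \<le> of_int (\<Sum>j\<in>\<pi> i. lot_size I j)"
      "of_int (\<Sum>j\<in>\<pi> i. lot_size I j) \<le> upper_size I i"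
      using that unfolding feasible_def lower_size_def upper_size_def by metis+
    then have "real_of_rat (lower_size I i) \<le> of_rat (of_int (\<Sum>j\<in>\<pi> i. lot_size I j))"
      "of_rat (of_int (\<Sum>j\<in>\<pi> i. lot_size I j)) \<le> real_of_rat (upper_size I i)"
      unfolding of_rat_less_eq .
    then show "real_of_rat (lower_size I i) \<le> of_int (\<Sum>j\<in>\<pi> i. lot_size I j) \<and>
      of_int (\<Sum>j\<in>\<pi> i. lot_size I j) \<le> real_of_rat (upper_size I i)"
      unfolding of_rat_of_int_eq by blast
    have "0 < lot_size I j" if "j \<in> \<pi> i" for j
      using I sub[OF that] by (auto simp: land_instance_def)
    then show "0 \<le> ?c \<pi> i"
      by (intro sum_nonneg mult_nonneg_nonneg) (auto simp: sq_dist_def less_imp_le)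
  qed
  have ge: "real_of_int (orig_size I i) / of_rat (lower_size I i) \<le> ?a"
    "real_of_rat (upper_size I i) / of_int (orig_size I i) \<le> ?b" if "i < ?p" for i
    using that by (auto intro!: Max_ge)
  have p: "0 < ?p" using I by (simp add: land_instance_def)
  \<comment> \<open>Farmer 0 exists and witnesses that \<open>?a\<close> is nonnegative, so
    inequalities may be multiplied by it.\<close>
  have "0 \<le> real_of_int (orig_size I 0) / of_rat (lower_size I 0)"
    using pos[OF p] by simp
  then have a0: "0 \<le> ?a" using ge(1)[OF p] by linarith
  have "f2 I \<pi> \<le> (\<Sum>i<?p. ?a * (1 / of_int (orig_size I i) * ?c \<pi> i))"
    unfolding f2_def
  proof (rule sum_mono)
    fix i assume "i \<in> {..<?p}"
    then have i: "i < ?p" by simp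
    have l: "0 < real_of_rat (lower_size I i)" "0 < real_of_int (orig_size I i)" using pos[OF i] by auto
    have "1 / of_int (\<Sum>j\<in>\<pi> i. lot_size I j) \<le> 1 / real_of_rat (lower_size I i)"
      using size[OF feas i] l by (intro frac_le) simp_all
    also have "\<dots> = real_of_int (orig_size I i) / of_rat (lower_size I i) * (1 / of_int (orig_size I i))"
      using l by simp
    also have "\<dots> \<le> ?a * (1 / of_int (orig_size I i))"
      using ge(1)[OF i] l by (intro mult_right_mono) auto
    finally have "1 / of_int (\<Sum>j\<in>\<pi> i. lot_size I j) * ?c \<pi> i \<le> ?a * (1 / of_int (orig_size I i)) * ?c \<pi> i"
      using c_nonneg[OF feas i] by (rule mult_right_mono)
    then show "1 / of_int (\<Sum>j\<in>\<pi> i. lot_size I j) * ?c \<pi> i \<le> ?a * (1 / of_int (orig_size I i) * ?c \<pi> i)"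
      by (simp only: mult.assoc)
  qed
  also have "\<dots> = ?a * f3 I \<pi>" unfolding f3_def by (rule sum_distrib_left[symmetric])
  also have "\<dots> \<le> ?a * f3 I \<pi>'" using opt a0 by (rule mult_left_mono)
  finally have 1: "f2 I \<pi> \<le> ?a * f3 I \<pi>'" .
  have "f3 I \<pi>' \<le> (\<Sum>i<?p. ?b * (1 / of_int (\<Sum>j\<in>\<pi>' i. lot_size I j) * ?c \<pi>' i))"
    unfolding f3_def
  proof (rule sum_mono)
    fix i assume "i \<in> {..<?p}"
    then have i: "i < ?p" by simp
    let ?s = "real_of_int (\<Sum>j\<in>\<pi>' i. lot_size I j)"
    have l: "0 < real_of_rat (lower_size I i)" "0 < real_of_int (orig_size I i)" using pos[OF i] by auto
    have s: "0 < ?s" "?s \<le> of_rat (upper_size I i)" using size[OF \<pi>' i] l by linarith+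
    have "1 / real_of_int (orig_size I i) = ?s / of_int (orig_size I i) * (1 / ?s)"
      using s by (simp del: of_int_sum)
    also have "\<dots> \<le> of_rat (upper_size I i) / of_int (orig_size I i) * (1 / ?s)"
      using s l by (intro mult_right_mono divide_right_mono) auto
    also have "\<dots> \<le> ?b * (1 / ?s)" using ge(2)[OF i] s(1) by (intro mult_right_mono) auto
    finally have "1 / real_of_int (orig_size I i) * ?c \<pi>' i \<le> ?b * (1 / ?s) * ?c \<pi>' i"
      using c_nonneg[OF \<pi>' i] by (rule mult_right_mono)
    then show "1 / real_of_int (orig_size I i) * ?c \<pi>' i \<le> ?b * (1 / ?s * ?c \<pi>' i)"
      by (simp only: mult.assoc)
  qed
  also have "\<dots> = ?b * f2 I \<pi>'" unfolding f2_def by (rule sum_distrib_left[symmetric])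
  finally have "?a * f3 I \<pi>' \<le> ?a * (?b * f2 I \<pi>')" using a0 by (rule mult_left_mono)
  with 1 show ?thesis unfolding approx_factor_def mult.assoc by (rule order_trans)
qed

theorem theorem4:
  fixes p s :: nat and \<Omega> :: "int mat set"
  assumes "\<Omega> \<subseteq> carrier_mat s p" and "finite \<Omega>"
  shows "poly_time_computable (instances p s \<Omega>) encode
           (\<lambda>I out. \<exists>\<pi>. out = encode_partition I \<pi> \<and> is_arg_min (f1 I) (feasible I) \<pi>) \<and>
         poly_time_computable (instances p s \<Omega>) encode
           (\<lambda>I out. \<exists>\<pi>. out = encode_partition I \<pi> \<and> is_arg_min (f3 I) (feasible I) \<pi>) \<and>
         poly_time_computable (instances p s \<Omega>) encode
           (\<lambda>I out. \<exists>\<pi>. out = encode_partition I \<pi> \<and> feasible I \<pi> \<and>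
              (\<forall>\<pi>'. feasible I \<pi>' \<longrightarrow> f2 I \<pi> \<le> approx_factor I * f2 I \<pi>'))"
proof -
  have weaken: "poly_time_computable X enc sol'"
    if "poly_time_computable X enc sol" "\<And>I out. I \<in> X \<Longrightarrow> sol I out \<Longrightarrow> sol' I out"
    for X :: "land set" and enc sol sol'
    using that unfolding poly_time_computable_def by meson
  have f3: "poly_time_computable (instances p s \<Omega>) encode
      (\<lambda>I out. \<exists>\<pi>. out = encode_partition I \<pi> \<and> is_arg_min (f3 I) (feasible I) \<pi>)"
    by (rule weaken[OF poly_time_objective[OF assms(2), where weighted = True]]) (simp add: objective_simps)
  moreover have "poly_time_computable (instances p s \<Omega>) encode
      (\<lambda>I out. \<exists>\<pi>. out = encode_partition I \<pi> \<and> is_arg_min (f1 I) (feasible I) \<pi>)"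
    by (rule weaken[OF poly_time_objective[OF assms(2), where weighted = False]]) (simp add: objective_simps)
  moreover have "poly_time_computable (instances p s \<Omega>) encode
      (\<lambda>I out. \<exists>\<pi>. out = encode_partition I \<pi> \<and> feasible I \<pi> \<and>
        (\<forall>\<pi>'. feasible I \<pi>' \<longrightarrow> f2 I \<pi> \<le> approx_factor I * f2 I \<pi>'))"
  proof (rule weaken[OF f3])
    fix I out
    assume "I \<in> instances p s \<Omega>"
      and "\<exists>\<pi>. out = encode_partition I \<pi> \<and> is_arg_min (f3 I) (feasible I) \<pi>"
    then obtain \<pi> where "land_instance I" "out = encode_partition I \<pi>" "is_arg_min (f3 I) (feasible I) \<pi>"
      unfolding instances_def by blast
    then show "\<exists>\<pi>. out = encode_partition I \<pi> \<and> feasible I \<pi> \<and>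
        (\<forall>\<pi>'. feasible I \<pi>' \<longrightarrow> f2 I \<pi> \<le> approx_factor I * f2 I \<pi>')"
      using f2_f3_ratio by (auto simp: is_arg_min_def)
  qed
  ultimately show ?thesis by blast
qed

end
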